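(* Every graphing is a strong subgraphing of a compact graphing.
   Context: Fix an integer $D\ge1$. A graphing is a Borel graph $\mathbf{G}=(I,\mathcal{A},\lambda,E)$ on a standard probability space $(I,\mathcal{A},\lambda)$, with symmetric Borel edge set $E\subseteq I\times I$ and all degrees at most $D$, satisfying $\int_A\deg_B(x)\,d\lambda(x)=\int_B\deg_A(x)\,d\lambda(x)$ for all Borel $A,B\subseteq I$, where $\deg_B(x)$ is the number of edges from $x$ to points of $B$. For $x$ a node and an integer $r\ge0$, $B(x,r)$ denotes the subgraph induced by the nodes at graph distance at most $r$ from $x$. For nodes $x,y$, a neighborhood isomorphism between $x$ and $y$ is a graph isomorphism $\phi:B(x,r)\to B(y,r)$ for some integer $r\ge0$ (its radius) with $\phi(x)=y$. A graphing $\mathbf{G}$ is compact if its node set $J$ is a compact metric space (with metric $d$, the sigma-algebra being the Borel sets of $(J,d)$), $E$ is a closed subset of $J\times J$, and for every $\varepsilon>0$ there is $\delta>0$ such that whenever $x,y\in J$ and $d(x,y)<\delta$, there is a neighborhood isomorphism $\phi$ between $x$ and $y$ with radius $r\ge 1/\varepsilon-1$ such that $d(z,\phi(z))\le\varepsilon$ for every $z\in B(x,r)$. A graphing $\mathbf{G}=(I,\mathcal{A},\lambda,E)$ is a strong subgraphing of a graphing $\mathbf{G}'=(I',\mathcal{A}',\lambda',E')$ if $I\subseteq I'$ and $\mathbf{G}$ is the union of connected components of $\mathbf{G}'$, the Borel subsets of $I$ are exactly the restrictions to $I$ of the Borel subsets of $I'$, and $\lambda'(X)=\lambda(I\cap X)$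 for every Borel subset $X$ of $I'$. *)

theory Defs
  imports "HOL-Probability.Probability"
begin

section \<open>Standard probability spaces\<close>

definition borel_of :: "'a topology \<Rightarrow> 'a measure" where
  "borel_of T = sigma (topspace T) {U. openin T U}"

definition standard_borel :: "'a measure \<Rightarrow> bool" where
  "standard_borel M \<longleftrightarrow>
     (\<exists>T. completely_metrizable_space T \<and> separable_space T \<and> sets M = sets (borel_of T))"

definition standard_prob_space :: "'a measure \<Rightarrow> bool" where
  "standard_prob_space M \<longleftrightarrow> standard_borel M \<and> prob_space M"


section \<open>Graphs as edge relations\<close>

text \<open>
  A graph is given by a node set and a symmetric irreflexive edge set, each edge \<open>xy\<close> being
  represented by both ordered pairs \<open>(x, y)\<close> and \<open>(y, x)\<close>.
\<close>

definition deg :: "('a \<times> 'a) set \<Rightarrow> 'a set \<Rightarrow> 'a \<Rightarrow> nat" where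
  "deg E B x = card {y \<in> B. (x, y) \<in> E}"

definition gball :: "'a set \<Rightarrow> ('a \<times> 'a) set \<Rightarrow> 'a \<Rightarrow> nat \<Rightarrow> 'a set" where
  "gball V E x r = {y \<in> V. \<exists>n\<le>r. (x, y) \<in> E ^^ n}"

definition neighborhood_iso ::
  "'a set \<Rightarrow> ('a \<times> 'a) set \<Rightarrow> nat \<Rightarrow> 'a \<Rightarrow> 'a \<Rightarrow> ('a \<Rightarrow> 'a) \<Rightarrow> bool" where
  "neighborhood_iso V E r x y \<phi> \<longleftrightarrow>
     bij_betw \<phi> (gball V E x r) (gball V E y r) \<and>
     (\<forall>u\<in>gball V E x r. \<forall>v\<in>gball V E x r. (u, v) \<in> E \<longleftrightarrow> (\<phi> u, \<phi> v) \<in> E) \<and>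
     \<phi> x = y"

definition connected_comps :: "'a set \<Rightarrow> ('a \<times> 'a) set \<Rightarrow> 'a set set" where
  "connected_comps V E = {{y \<in> V. (x, y) \<in> E\<^sup>*} | x. x \<in> V}"


section \<open>Graphings\<close>

text \<open>
  The measure \<open>M\<close> carries the node set \<open>space M\<close>, its Borel sets \<open>sets M\<close> and the probability
  measure. The degrees are nonnegative, so the integrals in the measure-preservation condition
  are taken in \<open>ennreal\<close>; finiteness of the neighborhoods makes \<^const>\<open>deg\<close> the true degree.
\<close>

definition graphing :: "nat \<Rightarrow> 'a measure \<Rightarrow> ('a \<times> 'a) set \<Rightarrow> bool" where
  "graphing D M E \<longleftrightarrow>
     standard_prob_space M \<and>
     E \<in> sets (M \<Otimes>\<^sub>M M) \<and> sym E \<and> irrefl E \<and>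
     (\<forall>x\<in>space M. finite {y \<in> space M. (x, y) \<in> E} \<and> deg E (space M) x \<le> D) \<and>
     (\<forall>A\<in>sets M. \<forall>B\<in>sets M.
        (\<integral>\<^sup>+x\<in>A. of_nat (deg E B x) \<partial>M) = (\<integral>\<^sup>+x\<in>B. of_nat (deg E A x) \<partial>M))"

definition compact_graphing :: "nat \<Rightarrow> 'a measure \<Rightarrow> ('a \<times> 'a) set \<Rightarrow> bool" where
  "compact_graphing D M E \<longleftrightarrow>
     graphing D M E \<and>
     (\<exists>d. Metric_space (space M) d \<and>
          compact_space (Metric_space.mtopology (space M) d) \<and>
          sets M = sets (borel_of (Metric_space.mtopology (space M) d)) \<and>
          closedin (prod_topology (Metric_space.mtopology (space M) d)
                                  (Metric_space.mtopology (space M) d)) E \<and>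
          (\<forall>\<epsilon>>0. \<exists>\<delta>>0. \<forall>x\<in>space M. \<forall>y\<in>space M. d x y < \<delta> \<longrightarrow>
             (\<exists>r \<phi>. real r \<ge> 1 / \<epsilon> - 1 \<and> neighborhood_iso (space M) E r x y \<phi> \<and>
                    (\<forall>z\<in>gball (space M) E x r. d z (\<phi> z) \<le> \<epsilon>))))"

definition strong_subgraphing ::
  "'a measure \<Rightarrow> ('a \<times> 'a) set \<Rightarrow> 'a measure \<Rightarrow> ('a \<times> 'a) set \<Rightarrow> bool" where
  "strong_subgraphing M E M' E' \<longleftrightarrow>
     space M \<subseteq> space M' \<and>
     (\<exists>\<C> \<subseteq> connected_comps (space M') E'. space M = \<Union>\<C>) \<and>
     E = E' \<inter> (space M \<times> space M) \<and>
     sets M = (\<lambda>X. space M \<inter> X) ` sets M' \<and>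
     (\<forall>X\<in>sets M'. emeasure M' X = emeasure M (space M \<inter> X))"

text \<open>
  A compact graphing containing a given one in general needs new nodes, for which the node type
  may have no room. The copy of a graphing along \<^const>\<open>Inl\<close>, with measure
  \<^term>\<open>embed_measure M Inl\<close>, lives in a type with room for new nodes. A compact metric space
  has at most continuum many points, so \<open>'a + real\<close> is always large enough.
\<close>

definition edges_Inl :: "('a \<times> 'a) set \<Rightarrow> (('a + 'b) \<times> ('a + 'b)) set" where
  "edges_Inl E = map_prod Inl Inl ` E"

end

theory Submission
  imports Defs
begin

text \<open>
  By the Lusin--Souslin theorem, a Borel graph of degree at most \<open>D\<close> is covered by the graphs of
  Borel maps \<open>f\<^sub>0, \<dots>, f\<^bsub>D-1\<^esub>\<close>; words in these maps reach the whole component of a node. To a node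
  \<open>x\<close> we attach countably many bits: which sets of a generating sequence contain \<open>x\<close>, which pairs
  of words lead from \<open>x\<close> to the same node, and the colours of \<open>x\<close> in finite Borel colourings that
  separate all nodes at distance at most \<open>r\<close>, one for every \<open>r\<close>. The code of \<open>x\<close> lists
  the bits of all nodes reached from \<open>x\<close> along words; following \<open>f\<^sub>i\<close> becomes a shift of codes.
  The compact graphing lives on the closure of the set of codes in the Cantor space, with shifts as edges
  and the push-forward measure. If two words lead to the same node, equality persists
  in the limit. If they lead to different nodes, these differ in one of finitely many colours, so they
  stay different in the limit. Hence finitely many bits of a code determine its neighbourhood of
  radius \<open>r\<close> up to isomorphism, and moving along the same words is a neighbourhood isomorphism
  between nearby codes.
\<close>

section \<open>The Lusin--Souslin theorem\<close>

text \<open>The obstacle is that inequality is an open condition: in the closure distinct nodes may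
  collapse, while neighbourhoods must keep their isomorphism type and the loop-free edge set must be
  closed. An \<open>Eq\<close> bit alone would only remember that two nodes were different; the
  colours make the shifted codes themselves differ. Finitely many colours per radius are needed,
  since with infinitely many a limit code might carry no colour at all. Coincidence of two moves
  thus becomes a single bit, a clopen condition.

  The measure causes no trouble: the push-forward integrates over the given nodes only. The
  Lusin--Souslin theorem is what allows the nodes to be coded by reals, whose order then selects
  least neighbours in a Borel way.\<close>

definition borel_separated :: "'a::topological_space set \<Rightarrow> 'a set \<Rightarrow> bool" where
  "borel_separated A B \<longleftrightarrow> (\<exists>S\<in>sets borel. A \<subseteq> S \<and> B \<inter> S = {})"

text \<open>Used in contrapositive form: if two countable unions cannot be separated, some pair of
  pieces cannot, so a failure can be pushed into ever smaller pieces.\<close>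

lemma borel_separated_Union:
  fixes A B :: "nat \<Rightarrow> 'a::topological_space set"
  assumes "\<And>n m. borel_separated (A n) (B m)"
  shows "borel_separated (\<Union>n. A n) (\<Union>m. B m)"
proof -
  obtain S where S: "\<And>n m. S n m \<in> sets borel" "\<And>n m. A n \<subseteq> S n m" "\<And>n m. B m \<inter> S n m = {}"
    using assms unfolding borel_separated_def by metis
  have "(\<Union>n. \<Inter>m. S n m) \<in> sets borel" using S(1) by blast
  moreover have "(\<Union>n. A n) \<subseteq> (\<Union>n. \<Inter>m. S n m)" using S(2) by blast
  moreover have "(\<Union>m. B m) \<inter> (\<Union>n. \<Inter>m. S n m) = {}" using S(3) by blast
  ultimately show ?thesis unfolding borel_separated_def by blast
qed

lemma dense_sequence:
  obtains d :: "nat \<Rightarrow> 'a::{metric_space, second_countable_topology}"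
  where "\<And>x e. e > 0 \<Longrightarrow> \<exists>n. dist (d n) x < e"
proof -
  obtain D :: "'a set" where D: "countable D" "\<And>X. open X \<Longrightarrow> X \<noteq> {} \<Longrightarrow> \<exists>d\<in>D. d \<in> X"
    using countable_dense_setE by blast
  have "D \<noteq> {}" using D(2)[of UNIV] by auto
  have "\<exists>n. dist (from_nat_into D n) x < e" if e: "e > 0" for x e
  proof -
    have "ball x e \<noteq> {}" using e by (auto intro!: exI[of _ x])
    then obtain y where "y \<in> D" "y \<in> ball x e" using D(2)[of "ball x e"] by auto
    moreover obtain n where "y = from_nat_into D n"
      using from_nat_into_surj[OF D(1) \<open>y \<in> D\<close>] by metis
    ultimately show ?thesis by (auto simp: dist_commute)
  qed
  then show ?thesis using that by blast
qed

text \<open>A failure of separation descends to pairs of closed pieces of diameter tending to 0,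
  which by completeness shrink to points \<open>a\<close> and \<open>b\<close>. As
  \<open>f a\<close> and \<open>f b\<close> differ, an open set around \<open>f a\<close> separates
  the images once the pieces are small.\<close>

theorem lusin_separation:
  fixes f :: "'a::polish_space \<Rightarrow> 'b::t2_space"
  assumes f: "continuous_on UNIV f" and "closed A" "closed B" and disj: "f ` A \<inter> f ` B = {}"
  shows "borel_separated (f ` A) (f ` B)"
proof (rule ccontr)
  assume nsep: "\<not> ?thesis"
  obtain d :: "nat \<Rightarrow> 'a" where d: "\<And>x e. e > 0 \<Longrightarrow> \<exists>n. dist (d n) x < e"
    using dense_sequence by blast
  define P where "P = (\<lambda>(k::nat) (Q::'a set \<times> 'a set). closed (fst Q) \<and> closed (snd Q) \<and>
     fst Q \<subseteq> A \<and> snd Q \<subseteq> B \<and> \<not> borel_separated (f ` fst Q) (f ` snd Q))"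
  define R where "R = (\<lambda>(k::nat) (Q::'a set \<times> 'a set) (Q'::'a set \<times> 'a set).
     fst Q' \<subseteq> fst Q \<and> snd Q' \<subseteq> snd Q \<and> (\<exists>n m. fst Q' \<subseteq> cball (d n) (inverse (Suc k))
       \<and> snd Q' \<subseteq> cball (d m) (inverse (Suc k))))"
  have "\<exists>F. \<forall>k. P k (F k) \<and> R k (F k) (F (Suc k))"
  proof (rule dependent_nat_choice)
    show "\<exists>Q. P 0 Q" using nsep assms unfolding P_def by (intro exI[of _ "(A, B)"]) auto
  next
    fix Q k assume PQ: "P k Q"
    have cov: "(\<Union>n. X \<inter> cball (d n) (inverse (Suc k))) = X" for X
    proof (intro equalityI subsetI)
      fix x assume "x \<in> X"
      obtain n where "dist (d n) x < inverse (Suc k)" using d[of "inverse (Suc k)" x] by auto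
      then show "x \<in> (\<Union>n. X \<inter> cball (d n) (inverse (Suc k)))"
        using \<open>x \<in> X\<close> by (auto intro!: exI[of _ n])
    qed auto
    have "\<exists>n m. \<not> borel_separated (f ` (fst Q \<inter> cball (d n) (inverse (Suc k))))
                                 (f ` (snd Q \<inter> cball (d m) (inverse (Suc k))))"
    proof (rule ccontr)
      assume "\<not> ?thesis"
      then have "borel_separated (\<Union>n. f ` (fst Q \<inter> cball (d n) (inverse (Suc k))))
                                 (\<Union>m. f ` (snd Q \<inter> cball (d m) (inverse (Suc k))))"
        by (intro borel_separated_Union) blast
      then show False using PQ unfolding image_UN[symmetric] cov P_def by blast
    qed
    then obtain n m where nm: "\<not> borel_separated (f ` (fst Q \<inter> cball (d n) (inverse (Suc k))))
                                 (f ` (snd Q \<inter> cball (d m) (inverse (Suc k))))" by blast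
    show "\<exists>Q'. P (Suc k) Q' \<and> R k Q Q'"
      using PQ nm unfolding P_def R_def
      by (intro exI[of _ "(fst Q \<inter> cball (d n) (inverse (Suc k)), snd Q \<inter> cball (d m) (inverse (Suc k)))"])
         (auto simp: closed_Int)
  qed
  then obtain F where FP: "\<And>k. P k (F k)" and FR: "\<And>k. R k (F k) (F (Suc k))" by blast
  have dec: "decseq (\<lambda>k. fst (F k))" "decseq (\<lambda>k. snd (F k))"
    using FR unfolding R_def by (simp_all add: decseq_Suc_iff)
  have ne: "fst (F k) \<noteq> {} \<and> snd (F k) \<noteq> {}" for k
  proof -
    have "borel_separated {} Y" "borel_separated X {}" for X Y :: "'b set"
      unfolding borel_separated_def by (rule bexI[of _ "{}"]; simp) (rule bexI[of _ UNIV]; simp)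
    then show ?thesis using FP[of k] unfolding P_def by fastforce
  qed
  have small: "\<exists>k. \<forall>x\<in>T k. \<forall>y\<in>T k. dist x y < e"
    if T: "\<And>k. \<exists>n. T (Suc k) \<subseteq> cball (d n) (inverse (Suc k))" and "e > 0" for T :: "nat \<Rightarrow> 'a set" and e
  proof -
    obtain k where k: "inverse (real (Suc k)) < e / 2" using reals_Archimedean[of "e/2"] \<open>e > 0\<close> by auto
    obtain n where n: "T (Suc k) \<subseteq> cball (d n) (inverse (Suc k))" using T by blast
    have "dist x y < e" if "x \<in> T (Suc k)" "y \<in> T (Suc k)" for x y
    proof -
      have "dist (d n) x \<le> inverse (Suc k)" "dist (d n) y \<le> inverse (Suc k)" using n that by auto
      then show ?thesis using dist_triangle3[of x y "d n"] k by linarith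
    qed
    then show ?thesis by blast
  qed
  have s1: "\<exists>k. \<forall>x\<in>fst (F k). \<forall>y\<in>fst (F k). dist x y < e" if "e > 0" for e
    by (rule small) (use FR that in \<open>auto simp: R_def\<close>)
  have s2: "\<exists>k. \<forall>x\<in>snd (F k). \<forall>y\<in>snd (F k). dist x y < e" if "e > 0" for e
    by (rule small) (use FR that in \<open>auto simp: R_def\<close>)
  obtain a where a: "\<And>k. a \<in> fst (F k)"
    using decreasing_closed_nest[of "\<lambda>k. fst (F k)"] s1 ne dec(1) FP
    unfolding P_def decseq_def by metis
  obtain b where b: "\<And>k. b \<in> snd (F k)"
    using decreasing_closed_nest[of "\<lambda>k. snd (F k)"] s2 ne dec(2) FP
    unfolding P_def decseq_def by metis
  have "a \<in> A" "b \<in> B" using FP[of 0] a[of 0] b[of 0] unfolding P_def by auto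
  then have "f a \<noteq> f b" using disj by blast
  then obtain U V where UV: "open U" "open V" "f a \<in> U" "f b \<in> V" "U \<inter> V = {}"
    using hausdorff by meson
  have oU: "open (f -` U)" "open (f -` V)"
    using f UV continuous_on_open_vimage[of UNIV f] by auto
  obtain e1 where e1: "e1 > 0" "ball a e1 \<subseteq> f -` U"
    using oU(1) UV(3) openE[of "f -` U" a] by auto
  obtain e2 where e2: "e2 > 0" "ball b e2 \<subseteq> f -` V"
    using oU(2) UV(4) openE[of "f -` V" b] by auto
  obtain k1 where k1: "\<forall>x\<in>fst (F k1). \<forall>y\<in>fst (F k1). dist x y < e1" using s1 e1 by blast
  obtain k2 where k2: "\<forall>x\<in>snd (F k2). \<forall>y\<in>snd (F k2). dist x y < e2" using s2 e2 by blast
  define k where "k = max k1 k2"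
  have "fst (F k) \<subseteq> fst (F k1)" "snd (F k) \<subseteq> snd (F k2)"
    using dec unfolding decseq_def k_def by auto
  then have "fst (F k) \<subseteq> ball a e1" "snd (F k) \<subseteq> ball b e2" using k1 k2 a b by (auto simp: subset_iff)
  then have "f ` fst (F k) \<subseteq> U" "f ` snd (F k) \<inter> U = {}" using e1 e2 UV by blast+
  then have "borel_separated (f ` fst (F k)) (f ` snd (F k))"
    unfolding borel_separated_def using borel_open[OF UV(1)] by (intro bexI[of _ U]) simp_all
  then show False using FP[of k] unfolding P_def by blast
qed

text \<open>Injectivity makes the images of \<open>C \<inter> U k n\<close> and
  \<open>C - U k n\<close> disjoint, hence separable, so a Borel condition on \<open>f w\<close>
  decides whether \<open>w\<close> lies in a given ball. A value \<open>y\<close> has a preimage iff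
  it selects a ball at every scale and never two incompatible ones; approximate preimages are then
  Cauchy.\<close>

lemma lusin_souslin_closed:
  fixes f :: "'a::polish_space \<Rightarrow> 'b::metric_space"
  assumes f: "continuous_on UNIV f" and C: "closed C" and inj: "inj_on f C"
  shows "f ` C \<in> sets borel"
proof -
  obtain d :: "nat \<Rightarrow> 'a" where d: "\<And>x e. e > 0 \<Longrightarrow> \<exists>n. dist (d n) x < e"
    using dense_sequence by blast
  define U where "U = (\<lambda>k n. ball (d n) (inverse (real (Suc k))))"
  have sep: "borel_separated (f ` (C \<inter> U k n)) (f ` (C - U k n))" for k n
  proof -
    \<comment> \<open>Separation is available for closed sets only, so the open ball is exhausted by
      closed ones.\<close>
    have U: "U k n = (\<Union>j. cball (d n) (inverse (real (Suc k)) - inverse (real (Suc j))))"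
      unfolding U_def
    proof (intro equalityI subsetI)
      fix x assume "x \<in> ball (d n) (inverse (real (Suc k)))"
      then have "0 < inverse (real (Suc k)) - dist (d n) x" by simp
      then obtain j where "inverse (real (Suc j)) < inverse (real (Suc k)) - dist (d n) x"
        using reals_Archimedean by blast
      then show "x \<in> (\<Union>j. cball (d n) (inverse (real (Suc k)) - inverse (real (Suc j))))"
        by (auto intro!: exI[of _ j])
    next
      fix x assume "x \<in> (\<Union>j. cball (d n) (inverse (real (Suc k)) - inverse (real (Suc j))))"
      then obtain j where "dist (d n) x \<le> inverse (real (Suc k)) - inverse (real (Suc j))" by auto
      moreover have "inverse (real (Suc j)) > 0" by simp
      ultimately show "x \<in> ball (d n) (inverse (real (Suc k)))" unfolding mem_ball by linarith
    qed
    have "borel_separated (f ` (C \<inter> cball (d n) (inverse (real (Suc k)) - inverse (real (Suc j)))))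
       (f ` (C - U k n))" for j
    proof (rule lusin_separation[OF f])
      show "closed (C - U k n)" using C unfolding U_def by (simp add: closed_Diff)
      show "f ` (C \<inter> cball (d n) (inverse (real (Suc k)) - inverse (real (Suc j)))) \<inter> f ` (C - U k n) = {}"
        using inj U by (auto dest!: inj_onD)
    qed (use C in auto)
    then have "borel_separated
        (\<Union>j. f ` (C \<inter> cball (d n) (inverse (real (Suc k)) - inverse (real (Suc j)))))
        (\<Union>j::nat. f ` (C - U k n))"
      by (intro borel_separated_Union) blast
    moreover have "(\<Union>j. f ` (C \<inter> cball (d n) (inverse (real (Suc k)) - inverse (real (Suc j)))))
        = f ` (C \<inter> U k n)"
      unfolding U image_UN[symmetric] Int_UN_distrib ..
    ultimately show ?thesis by simp
  qed
  then obtain S where S: "\<And>k n. S k n \<in> sets borel" "\<And>k n. f ` (C \<inter> U k n) \<subseteq> S k n"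
      "\<And>k n. f ` (C - U k n) \<inter> S k n = {}"
    unfolding borel_separated_def by metis
  \<comment> \<open>The closure supplies points of \<open>C \<inter> U k n\<close> whose images
    approach a given element of \<open>T k n\<close>.\<close>
  define T where "T = (\<lambda>k n. S k n \<inter> closure (f ` (C \<inter> U k n)))"
  have T: "T k n \<in> sets borel" for k n unfolding T_def using S(1) by auto
  have TC: "f w \<in> T k n \<longleftrightarrow> w \<in> U k n" if "w \<in> C" for w k n
    unfolding T_def using S(2,3)[of k n] that closure_subset[of "f ` (C \<inter> U k n)"] by blast
  \<comment> \<open>Pairs of balls without a common point in \<open>C\<close>; no value of
    \<open>f\<close> on \<open>C\<close> lies in both sets of such a pair.\<close>
  define I where "I = {((k, n), (k', n')). C \<inter> U k n \<inter> U k' n' = {}}"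
  have "f ` C = (\<Inter>k. \<Union>n. T k n) - (\<Union>((k, n), (k', n')) \<in> I. T k n \<inter> T k' n')" (is "_ = ?R")
  proof (intro equalityI subsetI)
    fix y assume "y \<in> f ` C"
    then obtain w where w: "w \<in> C" "y = f w" by blast
    have "\<exists>n. w \<in> U k n" for k unfolding U_def using d[of "inverse (real (Suc k))" w] by auto
    then show "y \<in> ?R" using TC[OF w(1)] w unfolding I_def by auto
  next
    fix y assume y: "y \<in> ?R"
    then have "\<forall>k. \<exists>n. y \<in> T k n" by blast
    then obtain n where n: "\<And>k. y \<in> T k (n k)" by metis
    have ne: "C \<inter> U k (n k) \<inter> U l (n l) \<noteq> {}" for k l
    proof
      assume "C \<inter> U k (n k) \<inter> U l (n l) = {}"
      then have "((k, n k), (l, n l)) \<in> I" unfolding I_def by simp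
      then have "y \<in> (\<Union>((k, n), (k', n')) \<in> I. T k n \<inter> T k' n')" using n[of k] n[of l] by force
      then show False using y by blast
    qed
    have "\<exists>p. p \<in> C \<and> p \<in> U k (n k) \<and> dist (f p) y < inverse (real (Suc k))" for k
    proof -
      have "y \<in> closure (f ` (C \<inter> U k (n k)))" using n[of k] unfolding T_def by blast
      then have "\<exists>z\<in>f ` (C \<inter> U k (n k)). dist z y < inverse (real (Suc k))"
        unfolding closure_approachable by simp
      then show ?thesis by blast
    qed
    then have "\<exists>p. \<forall>k. p k \<in> C \<and> p k \<in> U k (n k) \<and> dist (f (p k)) y < inverse (real (Suc k))"
      by (intro choice allI)
    then obtain p where p: "\<And>k. p k \<in> C" "\<And>k. p k \<in> U k (n k)"
        "\<And>k. dist (f (p k)) y < inverse (real (Suc k))" by blast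
    have pd: "dist (p k) (p l) \<le> 2 * inverse (real (Suc k)) + 2 * inverse (real (Suc l))" for k l
    proof -
      obtain q where q: "q \<in> U k (n k)" "q \<in> U l (n l)" using ne[of k l] by blast
      have "dist (p k) q < 2 * inverse (real (Suc k))"
        using q(1) p(2)[of k] dist_triangle3[of "p k" q "d (n k)"] unfolding U_def by auto
      moreover have "dist (p l) q < 2 * inverse (real (Suc l))"
        using q(2) p(2)[of l] dist_triangle3[of "p l" q "d (n l)"] unfolding U_def by auto
      ultimately show ?thesis using dist_triangle2[of "p k" "p l" q] by linarith
    qed
    have "Cauchy p"
    proof (rule metric_CauchyI)
      fix e :: real assume "e > 0"
      then obtain N where N: "inverse (real (Suc N)) < e / 4" using reals_Archimedean[of "e/4"] by auto
      have "dist (p k) (p l) < e" if "k \<ge> N" "l \<ge> N" for k l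
      proof -
        have "inverse (real (Suc k)) \<le> inverse (real (Suc N))" "inverse (real (Suc l)) \<le> inverse (real (Suc N))"
          using that by (auto intro!: le_imp_inverse_le)
        then show ?thesis using pd[of k l] N by linarith
      qed
      then show "\<exists>N. \<forall>m\<ge>N. \<forall>n\<ge>N. dist (p m) (p n) < e" by blast
    qed
    then obtain w where w: "p \<longlonglongrightarrow> w" using Cauchy_convergent convergent_def by blast
    then have "w \<in> C" using C p(1) closed_sequentially by blast
    have "(\<lambda>k. f (p k)) \<longlonglongrightarrow> f w"
      using f w continuous_on_tendsto_compose[of UNIV f p w sequentially] by simp
    moreover have "(\<lambda>k. f (p k)) \<longlonglongrightarrow> y"
    proof (rule metric_tendsto_imp_tendsto[OF LIMSEQ_inverse_real_of_nat])
      show "\<forall>\<^sub>F k in sequentially. dist (f (p k)) y \<le> dist (inverse (real (Suc k))) 0"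
        using p(3) by (intro always_eventually allI) (auto simp: less_imp_le)
    qed
    ultimately have "f w = y" using LIMSEQ_unique by blast
    then show "y \<in> f ` C" using \<open>w \<in> C\<close> by blast
  qed
  moreover have "?R \<in> sets borel"
  proof (rule sets.Diff)
    show "(\<Inter>k. \<Union>n. T k n) \<in> sets borel" using T by blast
    have "(case i of ((k, n), (k', n')) \<Rightarrow> T k n \<inter> T k' n') \<in> sets borel" for i
      using T by (cases i) (simp add: case_prod_beta)
    then show "(\<Union>((k, n), (k', n')) \<in> I. T k n \<inter> T k' n') \<in> sets borel"
      by (intro sets.countable_UN') (auto intro: countableI_type)
  qed
  ultimately show ?thesis by simp
qed

section \<open>Borel sets as injective projections of closed sets\<close>

instance prod :: (polish_space, polish_space) polish_space ..

text \<open>The factor \<open>nat \<Rightarrow> real\<close> is room for countably many uniquely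
  determined witnesses. Fixing the map to be \<open>fst\<close> lets witnesses for several sets
  share one base point.\<close>

definition lusin_set :: "'a::polish_space set \<Rightarrow> bool" where
  "lusin_set A \<longleftrightarrow> (\<exists>C :: ('a \<times> (nat \<Rightarrow> real)) set. closed C \<and> inj_on fst C \<and> fst ` C = A)"

lemma lusin_set_closed:
  assumes "closed A"
  shows "lusin_set A"
  unfolding lusin_set_def
  by (intro exI[of _ "A \<times> {\<lambda>_. 0}"]) (auto simp: assms closed_Times inj_on_def)

text \<open>Membership in an open set is witnessed by the reciprocal of the distance to the
  complement; the other coordinates are frozen at 0 to keep the witness unique.\<close>

lemma lusin_set_open:
  fixes A :: "'a::polish_space set"
  assumes "open A"
  shows "lusin_set A"
proof (cases "A = UNIV")
  \<comment> \<open>Treated apart because \<open>infdist\<close> to the empty complement is 0 by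
    convention.\<close>
  case True
  then show ?thesis by (simp add: lusin_set_closed)
next
  case False
  then have pos: "infdist x (- A) > 0 \<longleftrightarrow> x \<in> A" for x
    using in_closed_iff_infdist_zero[of "-A" x] assms infdist_nonneg[of x "-A"]
    by (auto simp: less_le)
  define C where "C = {p::'a \<times> (nat \<Rightarrow> real). snd p 0 * infdist (fst p) (-A) = 1} \<inter>
      (\<Inter>n. {p. snd p (Suc n) = 0})"
  have "closed C"
    unfolding C_def
    by (intro closed_Int closed_INT ballI closed_Collect_eq continuous_intros
        continuous_on_product_then_coordinatewise[OF continuous_on_snd[OF continuous_on_id]])
  moreover have "inj_on fst C"
  proof (rule inj_onI)
    fix p q assume pq: "p \<in> C" "q \<in> C" "fst p = fst q"
    have "snd p n = snd q n" for n
    proof (cases n)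
      case 0
      have "snd p 0 * infdist (fst p) (-A) = snd q 0 * infdist (fst p) (-A)" "infdist (fst p) (-A) \<noteq> 0"
        using pq unfolding C_def by auto
      then show ?thesis using 0 by simp
    qed (use pq in \<open>simp add: C_def\<close>)
    then show "p = q" using pq(3) by (auto simp: prod_eq_iff)
  qed
  moreover have "fst ` C = A"
  proof (intro equalityI subsetI)
    fix x assume "x \<in> fst ` C"
    then obtain t where "t * infdist x (-A) = 1" unfolding C_def by auto
    then have "infdist x (-A) \<noteq> 0" by auto
    then show "x \<in> A" using pos[of x] infdist_nonneg[of x "-A"] by linarith
  next
    fix x assume "x \<in> A"
    then have "(x, \<lambda>n. if n = 0 then inverse (infdist x (-A)) else 0) \<in> C"
      unfolding C_def using pos[of x] by simp
    then show "x \<in> fst ` C" by force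
  qed
  ultimately show ?thesis unfolding lusin_set_def by blast
qed

lemma continuous_on_reindex_snd:
  "continuous_on UNIV (\<lambda>p::'a::topological_space \<times> ('i \<Rightarrow> real). (fst p, \<lambda>k. snd p (h k)))"
  by (intro continuous_on_Pair continuous_on_fst continuous_on_id continuous_on_coordinatewise_then_product
      continuous_on_product_then_coordinatewise[OF continuous_on_snd[OF continuous_on_id]])

text \<open>The witnesses for all \<open>n\<close> are interleaved in one sequence by the pairing
  function; \<open>g n\<close> reads off the \<open>n\<close>-th.\<close>

lemma lusin_set_INT:
  fixes A :: "nat \<Rightarrow> 'a::polish_space set"
  assumes "\<And>n. lusin_set (A n)"
  shows "lusin_set (\<Inter>n. A n)"
proof -
  obtain C :: "nat \<Rightarrow> ('a \<times> (nat \<Rightarrow> real)) set"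
    where C: "\<And>n. closed (C n)" "\<And>n. inj_on fst (C n)" "\<And>n. fst ` C n = A n"
    using assms unfolding lusin_set_def by metis
  define g where "g = (\<lambda>n (p::'a \<times> (nat \<Rightarrow> real)). (fst p, \<lambda>k. snd p (prod_encode (n, k))))"
  define K where "K = (\<Inter>n. g n -` C n)"
  have "closed K"
    unfolding K_def g_def
    by (intro closed_INT ballI closed_vimage C continuous_on_reindex_snd)
  moreover have "inj_on fst K"
  proof (rule inj_onI)
    fix p q assume pq: "p \<in> K" "q \<in> K" "fst p = fst q"
    have "snd p m = snd q m" for m
    proof -
      obtain n k where m: "m = prod_encode (n, k)" by (metis prod_decode_inverse surj_pair)
      have "g n p = g n q"
        by (rule inj_onD[OF C(2)[of n]]) (use pq in \<open>auto simp: g_def K_def\<close>)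
      then show ?thesis unfolding m g_def by (auto dest: fun_cong[of _ _ k])
    qed
    then show "p = q" using pq(3) by (auto simp: prod_eq_iff)
  qed
  moreover have "fst ` K = (\<Inter>n. A n)"
  proof (intro equalityI subsetI)
    fix x assume "x \<in> fst ` K"
    then obtain p where "p \<in> K" "x = fst p" by blast
    then have "fst (g n p) = x" "g n p \<in> C n" for n unfolding K_def by (auto simp: g_def)
    then have "x \<in> A n" for n using imageI[of "g n p" "C n" fst] C(3)[of n] by simp
    then show "x \<in> (\<Inter>n. A n)" by blast
  next
    fix x assume "x \<in> (\<Inter>n. A n)"
    then have "x \<in> fst ` C n" for n using C(3) by auto
    then have "\<exists>t. (x, t) \<in> C n" for n by force
    then obtain t where t: "\<And>n. (x, t n) \<in> C n" by metis
    have "g n (x, \<lambda>m. case prod_decode m of (n, k) \<Rightarrow> t n k) = (x, t n)" for n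
      unfolding g_def by simp
    then have "(x, \<lambda>m. case prod_decode m of (n, k) \<Rightarrow> t n k) \<in> K" unfolding K_def using t by simp
    then show "x \<in> fst ` K" by force
  qed
  ultimately show ?thesis unfolding lusin_set_def by blast
qed

text \<open>Coordinate 0 of the witness names the set containing the point; by disjointness the
  point determines it, which preserves injectivity.\<close>

lemma lusin_set_disjoint_UN:
  fixes A :: "nat \<Rightarrow> 'a::polish_space set"
  assumes "\<And>n. lusin_set (A n)" and disj: "disjoint_family A"
  shows "lusin_set (\<Union>n. A n)"
proof -
  obtain C :: "nat \<Rightarrow> ('a \<times> (nat \<Rightarrow> real)) set"
    where C: "\<And>n. closed (C n)" "\<And>n. inj_on fst (C n)" "\<And>n. fst ` C n = A n"
    using assms unfolding lusin_set_def by metis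
  define g where "g = (\<lambda>(p::'a \<times> (nat \<Rightarrow> real)). (fst p, \<lambda>k. snd p (Suc k)))"
  \<comment> \<open>On \<open>\<nat>\<close> the condition \<open>t \<noteq> n\<close> is the closed condition \<open>\<bar>t - n\<bar> \<ge> 1\<close>.\<close>
  define K where "K = {p. snd p 0 \<in> \<nat>} \<inter> (\<Inter>n. {p. 1 \<le> \<bar>snd p 0 - real n\<bar>} \<union> g -` C n)"
  have K: "p \<in> K \<longleftrightarrow> (\<exists>n. snd p 0 = real n \<and> g p \<in> C n)" for p
  proof
    assume p: "p \<in> K"
    then obtain n where n: "snd p 0 = real n" unfolding K_def by (auto elim: Nats_cases)
    then show "\<exists>n. snd p 0 = real n \<and> g p \<in> C n" using p unfolding K_def by force
  next
    assume "\<exists>n. snd p 0 = real n \<and> g p \<in> C n"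
    then obtain n where n: "snd p 0 = real n" "g p \<in> C n" by blast
    have "1 \<le> \<bar>real n - real m\<bar>" if "m \<noteq> n" for m using that by linarith
    then show "p \<in> K" unfolding K_def using n by fastforce
  qed
  have cont0: "continuous_on UNIV (\<lambda>p::'a \<times> (nat \<Rightarrow> real). snd p 0)"
    by (intro continuous_on_product_then_coordinatewise[OF continuous_on_snd[OF continuous_on_id]])
  have "closed (\<nat> :: real set)"
  proof -
    have "(\<nat> :: real set) = \<int> \<inter> {0..}" by (auto simp: Nats_altdef2)
    then show ?thesis by (simp add: closed_Int)
  qed
  then have "closed ((\<lambda>p::'a \<times> (nat \<Rightarrow> real). snd p 0) -` \<nat>)" using cont0 by (rule closed_vimage)
  then have "closed K"
    unfolding K_def g_def vimage_def[of "\<lambda>p. snd p 0"]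
    by (intro closed_Int closed_INT ballI closed_Un closed_Collect_le continuous_on_const
        continuous_on_rabs continuous_on_diff cont0 closed_vimage C continuous_on_reindex_snd)
  moreover have "inj_on fst K"
  proof (rule inj_onI)
    fix p q assume pq: "p \<in> K" "q \<in> K" "fst p = fst q"
    obtain n where n: "snd p 0 = real n" "g p \<in> C n" using pq K by blast
    obtain m where m: "snd q 0 = real m" "g q \<in> C m" using pq K by blast
    have "fst (g p) = fst (g q)" using pq by (simp add: g_def)
    then have "fst (g p) \<in> A n \<inter> A m"
      using imageI[OF n(2), of fst] imageI[OF m(2), of fst] C(3) by simp
    then have "n = m" using disj unfolding disjoint_family_on_def by blast
    then have "g p = g q" using n m \<open>fst (g p) = fst (g q)\<close> C(2) by (metis inj_onD)
    then have "snd p (Suc k) = snd q (Suc k)" for k unfolding g_def by (auto dest: fun_cong[of _ _ k])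
    then have "snd p k = snd q k" for k using n m \<open>n = m\<close> by (cases k) auto
    then show "p = q" using pq(3) by (auto simp: prod_eq_iff)
  qed
  moreover have "fst ` K = (\<Union>n. A n)"
  proof (intro equalityI subsetI)
    fix x assume "x \<in> fst ` K"
    then obtain p where p: "p \<in> K" "x = fst p" by blast
    then obtain n where "g p \<in> C n" using K by blast
    moreover have "fst (g p) = x" using p by (simp add: g_def)
    ultimately show "x \<in> (\<Union>n. A n)" using imageI[of "g p" "C n" fst] C(3)[of n] by auto
  next
    fix x assume "x \<in> (\<Union>n. A n)"
    then obtain n where "x \<in> fst ` C n" using C(3) by auto
    then obtain t where t: "(x, t) \<in> C n" by force
    have "(x, case_nat (real n) t) \<in> K" unfolding K using t by (auto simp: g_def)
    then show "x \<in> fst ` K" by force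
  qed
  ultimately show ?thesis unfolding lusin_set_def by blast
qed

text \<open>The induction carries the complement along, since a projection of a closed set says
  nothing about its complement. Unions are first made disjoint, which again uses the
  complements.\<close>

lemma lusin_set_borel:
  fixes A :: "'a::polish_space set"
  assumes "A \<in> sets borel"
  shows "lusin_set A"
proof -
  have "A \<in> sigma_sets UNIV {S. open S}"
    using assms unfolding borel_def by (subst (asm) sets_measure_of) auto
  then have "lusin_set A \<and> lusin_set (- A)"
  proof induction
    case (Basic a)
    then show ?case by (auto intro: lusin_set_open lusin_set_closed)
  next
    case Empty
    then show ?case by (auto intro: lusin_set_closed)
  next
    case (Compl a)
    then show ?case by (auto simp: Compl_eq_Diff_UNIV[symmetric])
  next
    case (Union a)
    have "lusin_set (disjointed a n)" for n
    proof -
      have eq: "disjointed a n = (\<Inter>m. if m < n then - a m else a n)"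
      proof (intro equalityI subsetI)
        fix x assume "x \<in> (\<Inter>m. if m < n then - a m else a n)"
        then have h: "x \<in> (if m < n then - a m else a n)" for m by blast
        have "x \<notin> a m" if "m < n" for m using h[of m] that by simp
        then show "x \<in> disjointed a n" using h[of n] unfolding disjointed_def by simp
      qed (auto simp: disjointed_def)
      show ?thesis unfolding eq using Union by (intro lusin_set_INT) auto
    qed
    then have "lusin_set (\<Union>n. disjointed a n)"
      by (intro lusin_set_disjoint_UN disjoint_family_disjointed)
    moreover have "lusin_set (\<Inter>n. - a n)" using Union by (intro lusin_set_INT) auto
    ultimately show ?case by (simp add: UN_disjointed_eq)
  qed
  then show ?thesis ..
qed

text \<open>A Borel map is traded for a continuous one: its graph over \<open>A\<close> is Borel,
  hence an injective projection of a closed set, and on the graph the second projection is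
  injective.\<close>

theorem lusin_souslin:
  fixes f :: "'a::polish_space \<Rightarrow> 'b::polish_space"
  assumes A: "A \<in> sets borel" and f: "f \<in> borel_measurable borel" and inj: "inj_on f A"
  shows "f ` A \<in> sets borel"
proof -
  define G where "G = {p. fst p \<in> A \<and> snd p = f (fst p)}"
  have "G = fst -` A \<inter> {p. dist (snd p) (f (fst p)) = 0}" unfolding G_def by auto
  moreover have "(fst :: 'a \<times> 'b \<Rightarrow> 'a) -` A \<in> sets borel"
    using measurable_sets[of fst borel borel A] A borel_measurable_continuous_onI[of fst]
    by (simp add: continuous_on_fst)
  moreover have "{p::'a \<times> 'b. dist (snd p) (f (fst p)) = 0} \<in> sets borel"
  proof -
    have [measurable]: "fst \<in> borel_measurable (borel :: ('a \<times> 'b) measure)"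
         "snd \<in> borel_measurable (borel :: ('a \<times> 'b) measure)"
      by (auto intro!: borel_measurable_continuous_onI continuous_intros)
    note f[measurable]
    show ?thesis by measurable
  qed
  ultimately have "G \<in> sets borel" by auto
  then obtain C :: "(('a \<times> 'b) \<times> (nat \<Rightarrow> real)) set" where
    C: "closed C" "inj_on fst C" "fst ` C = G"
    using lusin_set_borel[of G] unfolding lusin_set_def by auto
  have snd: "inj_on snd G" using inj unfolding G_def by (auto simp: inj_on_def prod_eq_iff)
  have "inj_on (snd \<circ> fst) C" using C snd by (intro comp_inj_on) auto
  moreover have "continuous_on UNIV (\<lambda>p::('a \<times> 'b) \<times> (nat \<Rightarrow> real). snd (fst p))"
    by (intro continuous_intros)
  ultimately have "(snd \<circ> fst) ` C \<in> sets borel"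
    using C(1) by (intro lusin_souslin_closed) (auto simp: comp_def)
  moreover have "snd ` G = f ` A" unfolding G_def by (auto simp: image_iff)
  ultimately show ?thesis using C(3) by (metis image_comp)
qed

section \<open>Coding standard Borel spaces by reals\<close>

text \<open>Base 3 with digits 0 and 1 makes the first differing digit decisive: all later terms
  together contribute at most half of its weight. In base 2 the tail could compensate it.\<close>

lemma ternary_expansion_inj:
  fixes b c :: "nat \<Rightarrow> bool"
  assumes eq: "(\<Sum>n. of_bool (b n) * (1/3 :: real) ^ n) = (\<Sum>n. of_bool (c n) * (1/3) ^ n)"
  shows "b = c"
proof (rule ccontr)
  assume "b \<noteq> c"
  define t where "t = (\<lambda>n. (of_bool (b n) - of_bool (c n)) * (1/3 :: real) ^ n)"
  have bound: "\<bar>t n\<bar> \<le> (1/3) ^ n" for n unfolding t_def by (auto simp: abs_mult)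
  have geo: "summable (\<lambda>n. (1/3 :: real) ^ n)" by (intro summable_geometric) simp
  have sb: "summable (\<lambda>n. of_bool (b n) * (1/3 :: real) ^ n)" for b :: "nat \<Rightarrow> bool"
    by (rule summable_comparison_test'[OF geo, of 0]) auto
  have st: "summable t" by (rule summable_comparison_test'[OF geo, of 0]) (use bound in auto)
  have sum0: "suminf t = 0"
    using eq suminf_diff[OF sb[of b] sb[of c]] unfolding t_def by (simp add: left_diff_distrib)
  obtain m where "b m \<noteq> c m" using \<open>b \<noteq> c\<close> by auto
  define n where "n = (LEAST n. b n \<noteq> c n)"
  have n: "b n \<noteq> c n" unfolding n_def by (rule LeastI[of "\<lambda>n. b n \<noteq> c n", OF \<open>b m \<noteq> c m\<close>])
  have "t i = 0" if "i < n" for i using not_less_Least[of i "\<lambda>n. b n \<noteq> c n"] that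
    unfolding t_def n_def by simp
  then have "(\<Sum>k. t (k + Suc n)) = - t n"
    using suminf_minus_initial_segment[OF st, of "Suc n"] sum0 by simp
  moreover have "\<bar>\<Sum>k. t (k + Suc n)\<bar> \<le> (1/3) ^ n / 2"
  proof -
    have "\<bar>t (k + Suc n)\<bar> \<le> (1/3) ^ Suc n * (1/3) ^ k" for k
      using bound[of "k + Suc n"] by (simp add: power_add mult.commute)
    then have "norm (\<Sum>k. t (k + Suc n)) \<le> (\<Sum>k. (1/3) ^ Suc n * (1/3) ^ k)"
      by (intro norm_suminf_le summable_mult geo) auto
    also have "\<dots> = (1/3) ^ Suc n * (3/2)"
      by (subst suminf_mult[OF geo]) (simp add: suminf_geometric)
    finally show ?thesis by simp
  qed
  moreover have "\<bar>t n\<bar> = (1/3) ^ n" using n unfolding t_def by (auto simp: abs_mult)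
  ultimately have "(1/3 :: real) ^ n \<le> (1/3) ^ n / 2" by simp
  then show False by simp
qed

text \<open>A point is determined by the basic open sets that contain it; these membership bits are
  read as ternary digits.\<close>

lemma borel_injection_real:
  "\<exists>h :: 'a::{second_countable_topology, t2_space} \<Rightarrow> real. h \<in> borel_measurable borel \<and> inj h"
proof -
  obtain B :: "nat \<Rightarrow> 'a set" where B: "\<And>n. open (B n)" "\<And>x U. open U \<Longrightarrow> x \<in> U \<Longrightarrow> \<exists>n. x \<in> B n \<and> B n \<subseteq> U"
  proof -
    obtain A :: "'a set set" where A: "countable A" "topological_basis A" using ex_countable_basis by blast
    then have "A \<noteq> {}" using topological_basisE[of A UNIV] by blast
    show ?thesis
    proof
      show "open (from_nat_into A n)" for n
        using A(2) from_nat_into[OF \<open>A \<noteq> {}\<close>] topological_basis_open by blast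
      fix x :: 'a and U assume "open U" "x \<in> U"
      then obtain V where "V \<in> A" "x \<in> V" "V \<subseteq> U" using topological_basisE[OF A(2)] by blast
      then show "\<exists>n. x \<in> from_nat_into A n \<and> from_nat_into A n \<subseteq> U"
        using from_nat_into_surj[OF A(1), of V] by metis
    qed
  qed
  define h where "h = (\<lambda>x. \<Sum>n. of_bool (x \<in> B n) * (1/3 :: real) ^ n)"
  have "(\<lambda>x. of_bool (x \<in> B n) :: real) \<in> borel_measurable borel" for n
    using borel_measurable_indicator[of "B n" borel] borel_open[OF B(1)[of n]]
    by (simp add: indicator_def of_bool_def)
  then have "h \<in> borel_measurable borel" unfolding h_def by (intro borel_measurable_suminf) simp
  moreover have "inj h"
  proof (rule injI, rule ccontr)
    fix x y assume "h x = h y" "x \<noteq> y"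
    then obtain U V where "open U" "x \<in> U" "y \<in> V" "U \<inter> V = {}" using hausdorff by meson
    then obtain n where "x \<in> B n" "y \<notin> B n" using B(2) by blast
    moreover have "(\<lambda>n. x \<in> B n) = (\<lambda>n. y \<in> B n)"
      using \<open>h x = h y\<close> unfolding h_def by (rule ternary_expansion_inj)
    ultimately show False by meson
  qed
  ultimately show ?thesis by blast
qed

lemma sets_borel_of: "sets (borel_of T) = sigma_sets (topspace T) {U. openin T U}"
  unfolding borel_of_def by (rule sets_measure_of) (auto dest: openin_subset)

lemma space_borel_of [simp]: "space (borel_of T) = topspace T"
  unfolding borel_of_def by (rule space_measure_of) (auto dest: openin_subset)

section \<open>Embedding a complete metric space by distances to a dense sequence\<close>

context Metric_space
begin

text \<open>The closure of the image may contain vectors that belong to no point. A vector in the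
  closure is genuine iff its entries come arbitrarily close to 0: indices with \<open>t n\<close>
  tending to 0 give a Cauchy sequence in the dense set, and its limit has the distances
  \<open>t\<close>.\<close>

lemma distance_sequence_image_borel:
  assumes complete: "mcomplete" and d: "range d' \<subseteq> M"
    and dense: "\<And>x e. x \<in> M \<Longrightarrow> e > 0 \<Longrightarrow> \<exists>n::nat. d x (d' n) < e"
  shows "(\<lambda>x n. d x (d' n)) ` M \<in> sets borel"
proof -
  define e where "e = (\<lambda>x n. d x (d' n))"
  have d': "d' n \<in> M" for n using d by auto
  have "e ` M = closure (e ` M) \<inter> (\<Inter>k. \<Union>n. {t. t n < inverse (real (Suc k))})"
  proof (intro equalityI subsetI)
    fix t assume "t \<in> e ` M"
    then obtain x where x: "x \<in> M" "t = e x" by blast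
    have "\<exists>n. t n < inverse (real (Suc k))" for k
      unfolding x(2) e_def using dense[OF x(1), of "inverse (real (Suc k))"] by simp
    then show "t \<in> closure (e ` M) \<inter> (\<Inter>k. \<Union>n. {t. t n < inverse (real (Suc k))})"
      using closure_subset[of "e ` M"] \<open>t \<in> e ` M\<close> by auto
  next
    fix t assume "t \<in> closure (e ` M) \<inter> (\<Inter>k. \<Union>n. {t. t n < inverse (real (Suc k))})"
    then have t: "t \<in> closure (e ` M)" and "\<forall>k. \<exists>n. t n < inverse (real (Suc k))" by auto
    then obtain n where n: "\<And>k. t (n k) < inverse (real (Suc k))" by metis
    obtain s where s: "\<And>j. s j \<in> e ` M" "s \<longlonglongrightarrow> t" using t closure_sequential by metis
    then obtain x where x: "\<And>j. x j \<in> M" "\<And>j. s j = e (x j)"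
      unfolding image_iff by metis
    have lim: "(\<lambda>j. d (x j) (d' i)) \<longlonglongrightarrow> t i" for i
      using continuous_on_tendsto_compose[OF continuous_on_product_coordinates[where i = i] s(2)]
      by (simp add: x(2) e_def)
    \<comment> \<open>Triangle inequalities survive the pointwise limit, so \<open>t\<close> behaves
      like the distances from an ideal point.\<close>
    have tri1: "d (d' i) (d' k) \<le> t i + t k" for i k
    proof (rule LIMSEQ_le_const[OF tendsto_add[OF lim lim]], intro exI allI impI)
      fix j show "d (d' i) (d' k) \<le> d (x j) (d' i) + d (x j) (d' k)"
        using triangle[OF d'[of i] x(1)[of j] d'[of k]] commute[of "d' i" "x j"] by linarith
    qed
    have tri2: "\<bar>d (d' i) (d' k) - t k\<bar> \<le> t i" for i k
    proof (rule LIMSEQ_le[OF tendsto_rabs[OF tendsto_diff[OF tendsto_const lim]] lim], intro exI allI impI)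
      fix j
      show "\<bar>d (d' i) (d' k) - d (x j) (d' k)\<bar> \<le> d (x j) (d' i)"
        using triangle[OF d'[of i] x(1)[of j] d'[of k]] triangle[OF x(1)[of j] d'[of i] d'[of k]]
          commute[of "d' i" "x j"] by linarith
    qed
    have "MCauchy (\<lambda>k. d' (n k))"
      unfolding MCauchy_def
    proof (intro conjI allI impI)
      show "range (\<lambda>k. d' (n k)) \<subseteq> M" using d by auto
      fix r :: real assume "r > 0"
      then obtain N where N: "inverse (real (Suc N)) < r / 2" using reals_Archimedean[of "r/2"] by auto
      have "d (d' (n k)) (d' (n l)) < r" if "N \<le> k" "N \<le> l" for k l
      proof -
        have "inverse (real (Suc k)) \<le> inverse (real (Suc N))" "inverse (real (Suc l)) \<le> inverse (real (Suc N))"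
          using that by (auto intro!: le_imp_inverse_le)
        then show ?thesis using tri1[of "n k" "n l"] n[of k] n[of l] N by linarith
      qed
      then show "\<exists>N. \<forall>k l. N \<le> k \<longrightarrow> N \<le> l \<longrightarrow> d (d' (n k)) (d' (n l)) < r" by blast
    qed
    then obtain y where "limitin mtopology (\<lambda>k. d' (n k)) y sequentially"
      using complete unfolding mcomplete_def by blast
    then have y: "y \<in> M" "\<And>r. r > 0 \<Longrightarrow> \<exists>N. \<forall>k\<ge>N. d (d' (n k)) y < r"
      unfolding limit_metric_sequentially by (blast, meson)
    have "e y i = t i" for i
    proof (rule ccontr)
      assume "e y i \<noteq> t i"
      define r where "r = \<bar>e y i - t i\<bar> / 2"
      have "r > 0" unfolding r_def using \<open>e y i \<noteq> t i\<close> by simp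
      obtain N1 where N1: "\<And>k. k \<ge> N1 \<Longrightarrow> d (d' (n k)) y < r" using y(2)[OF \<open>r > 0\<close>] by blast
      obtain N2 where N2: "inverse (real (Suc N2)) < r" using reals_Archimedean[OF \<open>r > 0\<close>] by auto
      define k where "k = max N1 N2"
      have "inverse (real (Suc k)) \<le> inverse (real (Suc N2))"
        unfolding k_def by (auto intro!: le_imp_inverse_le)
      then have "t (n k) < r" using n[of k] N2 by linarith
      moreover have "d (d' (n k)) y < r" using N1 unfolding k_def by simp
      moreover have "\<bar>d y (d' i) - d (d' (n k)) (d' i)\<bar> \<le> d (d' (n k)) y"
        using triangle[OF y(1) d'[of "n k"] d'[of i]] triangle[OF d'[of "n k"] y(1) d'[of i]] commute[of y "d' (n k)"]
        by linarith
      ultimately have "\<bar>d y (d' i) - t i\<bar> < 2 * r" using tri2[of "n k" i] by linarith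
      then show False unfolding r_def e_def by simp
    qed
    then have "t = e y" by auto
    then show "t \<in> e ` M" using y(1) by blast
  qed
  moreover have "{t :: nat \<Rightarrow> real. t n < r} \<in> sets borel" for n r
    by (intro borel_open open_Collect_less continuous_on_product_coordinates continuous_on_const)
  then have "closure (e ` M) \<inter> (\<Inter>k. \<Union>n. {t. t n < inverse (real (Suc k))}) \<in> sets borel" by auto
  ultimately show ?thesis unfolding e_def by simp
qed

text \<open>An open set is the union of the balls around members of the dense sequence that it
  contains, and such a ball is a condition on one coordinate; hence the distance map is a
  topological embedding.\<close>

lemma openin_distance_sequence:
  assumes "range d' \<subseteq> M" and dense: "\<And>x e. x \<in> M \<Longrightarrow> e > 0 \<Longrightarrow> \<exists>n::nat. d x (d' n) < e"
    and U: "openin mtopology U"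
  shows "\<exists>V. open V \<and> U = (\<lambda>x n. d x (d' n)) -` V \<inter> M"
proof -
  define V where "V = (\<Union>(n, q) \<in> {(n, q). mball (d' n) q \<subseteq> U}. {t :: nat \<Rightarrow> real. t n < q})"
  have "open V"
    unfolding V_def by (auto intro!: open_UN open_Collect_less continuous_on_product_coordinates continuous_on_const)
  moreover have "U = (\<lambda>x n. d x (d' n)) -` V \<inter> M"
  proof (intro equalityI subsetI)
    fix x assume "x \<in> U"
    then obtain r where r: "r > 0" "mball x r \<subseteq> U" and "x \<in> M"
      using U unfolding openin_mtopology by blast
    obtain n where n: "d x (d' n) < r / 2" using dense[OF \<open>x \<in> M\<close>, of "r/2"] r by auto
    have "mball (d' n) (r / 2) \<subseteq> mball x r"
    proof
      fix z assume "z \<in> mball (d' n) (r / 2)"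
      then show "z \<in> mball x r"
        using n triangle[of x "d' n" z] \<open>x \<in> M\<close> assms(1) by (auto simp: in_mball)
    qed
    then show "x \<in> (\<lambda>x n. d x (d' n)) -` V \<inter> M" using r n \<open>x \<in> M\<close> unfolding V_def by fastforce
  next
    fix x assume "x \<in> (\<lambda>x n. d x (d' n)) -` V \<inter> M"
    then obtain n q where "mball (d' n) q \<subseteq> U" "d x (d' n) < q" "x \<in> M" unfolding V_def by auto
    then show "x \<in> U" using assms(1) by (auto simp: in_mball commute[of x] subset_iff)
  qed
  ultimately show ?thesis by blast
qed

end

text \<open>The carrier is a bare set without a class instance, so results on
  \<open>polish_space\<close> types reach it only through this coding. One direction of the
  equivalence is Lusin--Souslin, the other the measurability of the code.\<close>

theorem standard_borel_real_coding:
  fixes M :: "'a measure"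
  assumes "standard_borel M" and ne: "space M \<noteq> {}"
  obtains \<rho> :: "'a \<Rightarrow> real"
  where "inj_on \<rho> (space M)" "\<And>A. A \<subseteq> space M \<Longrightarrow> A \<in> sets M \<longleftrightarrow> \<rho> ` A \<in> sets borel"
proof -
  obtain T where T: "completely_metrizable_space T" "separable_space T" "sets M = sets (borel_of T)"
    using assms(1) unfolding standard_borel_def by blast
  obtain X m where "Metric_space X m" and complete: "Metric_space.mcomplete X m"
    and Tm: "T = Metric_space.mtopology X m"
    using T(1) unfolding completely_metrizable_space_def by blast
  interpret Metric_space X m by fact
  have space: "space M = X" using sets_eq_imp_space_eq[OF T(3)] Tm by simp
  obtain C where C: "countable C" "C \<subseteq> X" "mtopology closure_of C = X"
    using T(2) unfolding separable_space_def Tm by auto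
  have "C \<noteq> {}" using C(3) ne space by auto
  define d where "d = from_nat_into C"
  have d: "range d \<subseteq> X" unfolding d_def using C(2) range_from_nat_into_subset[OF \<open>C \<noteq> {}\<close>] by blast
  have dense: "\<exists>n. m x (d n) < r" if xr: "x \<in> X" "r > 0" for x r
  proof -
    have "x \<in> mtopology closure_of C" using that C(3) by simp
    then have "\<forall>r>0. \<exists>y\<in>C. y \<in> mball x r" unfolding metric_closure_of by blast
    then obtain y where "y \<in> C" "y \<in> mball x r" using xr(2) by blast
    moreover obtain n where "y = d n" unfolding d_def
      using from_nat_into_surj[OF C(1) \<open>y \<in> C\<close>] by metis
    ultimately show ?thesis by (auto simp: in_mball)
  qed
  define e where "e = (\<lambda>x n. m x (d n))"
  have inj_e: "inj_on e X"
  proof (rule inj_onI, rule ccontr)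
    fix x y assume xy: "x \<in> X" "y \<in> X" "e x = e y" "x \<noteq> y"
    then have "m x y / 2 > 0" by (simp add: mdist_pos_less)
    then obtain n where n: "m x (d n) < m x y / 2" using dense xy by blast
    moreover have "m y (d n) = m x (d n)" using fun_cong[OF xy(3), of n] by (simp add: e_def)
    moreover have "m x y \<le> m x (d n) + m y (d n)" using triangle[of x "d n" y] xy d commute by (metis range_subsetD)
    ultimately show False by simp
  qed
  have meas_e: "e \<in> borel_measurable M"
  proof (rule measurable_coordinatewise_then_product)
    fix n
    show "(\<lambda>x. e x n) \<in> borel_measurable M"
    proof (rule borel_measurable_iff_less[THEN iffD2], intro allI)
      fix a
      have "{x \<in> space M. e x n < a} = mball (d n) a"
        unfolding space e_def using range_subsetD[OF d, of n] by (auto simp: in_mball commute)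
      then show "{x \<in> space M. e x n < a} \<in> sets M" unfolding T(3) sets_borel_of Tm by auto
    qed
  qed
  have e_sets: "e ` A \<in> sets borel" if A: "A \<in> sets M" for A
  proof -
    have "sigma_sets X {U. openin mtopology U} \<subseteq> sets (vimage_algebra X e borel)"
    proof -
      have "{U. openin mtopology U} \<subseteq> sets (vimage_algebra X e borel)"
        using openin_distance_sequence[OF d dense]
        by (auto simp: sets_vimage_algebra2 e_def dest!: borel_open)
      then show ?thesis using sets.sigma_sets_subset[of _ "vimage_algebra X e borel"] by simp
    qed
    then have "A \<in> sets (vimage_algebra X e borel)" using A unfolding T(3) sets_borel_of Tm by auto
    then obtain B where B: "B \<in> sets borel" "A = e -` B \<inter> X" by (auto simp: sets_vimage_algebra2)
    have "e ` A = B \<inter> e ` X" unfolding B(2) by auto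
    moreover have "e ` X \<in> sets borel"
      unfolding e_def by (rule distance_sequence_image_borel[OF complete d dense])
    ultimately show ?thesis using B(1) by simp
  qed
  obtain h :: "(nat \<Rightarrow> real) \<Rightarrow> real" where h: "h \<in> borel_measurable borel" "inj h"
    using borel_injection_real by blast
  have inj: "inj_on (\<lambda>x. h (e x)) X" using inj_e h(2) by (auto simp: inj_on_def)
  show ?thesis
  proof (rule that[of "\<lambda>x. h (e x)"])
    show "inj_on (\<lambda>x. h (e x)) (space M)" using inj space by simp
    fix A assume A: "A \<subseteq> space M"
    show "A \<in> sets M \<longleftrightarrow> (\<lambda>x. h (e x)) ` A \<in> sets borel"
    proof
      assume "A \<in> sets M"
      then have "h ` e ` A \<in> sets borel"
        using h e_sets by (intro lusin_souslin) (auto intro: inj_on_subset)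
      then show "(\<lambda>x. h (e x)) ` A \<in> sets borel" by (simp add: image_image)
    next
      assume *: "(\<lambda>x. h (e x)) ` A \<in> sets borel"
      have "(\<lambda>x. h (e x)) \<in> borel_measurable M" using measurable_compose[OF meas_e h(1)] .
      then have "(\<lambda>x. h (e x)) -` (\<lambda>x. h (e x)) ` A \<inter> space M \<in> sets M" using * measurable_sets by blast
      moreover have "(\<lambda>x. h (e x)) -` (\<lambda>x. h (e x)) ` A \<inter> space M = A"
        using inj A unfolding space by (auto dest: inj_onD)
      ultimately show "A \<in> sets M" by simp
    qed
  qed
qed

section \<open>Borel sets with bounded finite sections\<close>

lemma strict_increasing_enumeration_unique:
  fixes s t :: "nat \<Rightarrow> 'a::linorder"
  assumes "\<And>i. i < n \<Longrightarrow> s i < s (Suc i)" "\<And>i. i < n \<Longrightarrow> t i < t (Suc i)" "s ` {..n} = t ` {..n}" "i \<le> n"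
  shows "s i = t i"
proof -
  have srt: "sorted_wrt (<) (map u [0..<Suc n])" if "\<And>i. i < n \<Longrightarrow> u i < u (Suc i)" for u :: "nat \<Rightarrow> 'a"
  proof -
    have "u i < u j" if "i < j" "j \<le> n" for i j
      using that \<open>\<And>i. i < n \<Longrightarrow> u i < u (Suc i)\<close> by (induction j) (auto simp: less_Suc_eq intro: less_trans)
    then show ?thesis by (auto simp: sorted_wrt_iff_nth_less less_Suc_eq_le simp del: upt_Suc)
  qed
  have "map s [0..<Suc n] = map t [0..<Suc n]"
    using srt[of s] srt[of t] assms
    by (intro strict_sorted_equal) (auto simp del: upt_Suc simp: lessThan_Suc_atMost atLeast0LessThan)
  then show ?thesis using assms(4) by (auto simp del: upt_Suc simp: map_eq_conv)
qed

text \<open>Projections of Borel sets need not be Borel, but injective ones are. Points with exactly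
  \<open>Suc D\<close> section elements form the injective projection of the set of increasing
  enumerations; once they are removed, the bound drops by one.\<close>

lemma borel_fst_image_bounded_sections:
  fixes E :: "('a::polish_space \<times> real) set"
  assumes "E \<in> sets borel" "\<And>x. finite {y. (x, y) \<in> E} \<and> card {y. (x, y) \<in> E} \<le> D"
  shows "fst ` E \<in> sets borel"
  using assms
proof (induction D arbitrary: E)
  case 0
  then have "{y. (x, y) \<in> E} = {}" for x by (metis card_0_eq le_zero_eq)
  then have "E = {}" by auto
  then show ?case by simp
next
  case (Suc D)
  define S where "S = (\<lambda>x. {y. (x, y) \<in> E})"
  have fin: "finite (S x)" "card (S x) \<le> Suc D" for x using Suc.prems(2) unfolding S_def by auto
  \<comment> \<open>Entries beyond \<open>D\<close> are frozen at 0; with the order condition this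
    leaves one tuple per first component.\<close>
  define T where "T = {p :: 'a \<times> (nat \<Rightarrow> real). (\<forall>i\<le>D. (fst p, snd p i) \<in> E) \<and>
     (\<forall>i<D. snd p i < snd p (Suc i)) \<and> (\<forall>i>D. snd p i = 0)}"
  have [measurable]: "fst \<in> borel_measurable (borel :: ('a \<times> (nat \<Rightarrow> real)) measure)"
     "(\<lambda>p. snd p i) \<in> borel_measurable (borel :: ('a \<times> (nat \<Rightarrow> real)) measure)" for i
    by (auto intro!: borel_measurable_continuous_onI continuous_on_fst continuous_on_id
        continuous_on_product_then_coordinatewise[OF continuous_on_snd[OF continuous_on_id]])
  have "(\<lambda>p::'a \<times> (nat \<Rightarrow> real). (fst p, snd p i)) \<in> borel_measurable borel" for i
    by (rule borel_measurable_continuous_onI) (intro continuous_on_Pair continuous_on_fst continuous_on_id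
        continuous_on_product_then_coordinatewise[OF continuous_on_snd[OF continuous_on_id]])
  then have [measurable]: "Measurable.pred borel (\<lambda>p::'a \<times> (nat \<Rightarrow> real). (fst p, snd p i) \<in> E)" for i
    using Suc.prems(1) by (rule pred_sets2[rotated])
  have "T = {p \<in> space borel. (\<forall>i\<le>D. (fst p, snd p i) \<in> E) \<and>
     (\<forall>i<D. snd p i < snd p (Suc i)) \<and> (\<forall>i>D. snd p i = 0)}" unfolding T_def by simp
  also have "\<dots> \<in> sets borel" by measurable
  finally have T: "T \<in> sets borel" .
  have enum: "snd p ` {..D} = S (fst p)" "card (S (fst p)) = Suc D" if p: "p \<in> T" for p
  proof -
    have mono: "snd p i < snd p j" if "i < j" "j \<le> D" for i j
      using that p unfolding T_def by (induction j) (auto simp: less_Suc_eq intro: less_trans)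
    then have "inj_on (snd p) {..D}" 
      by (intro linorder_inj_onI') (metis mono atMost_iff less_irrefl)
    then have "card (snd p ` {..D}) = Suc D" by (simp add: card_image)
    moreover have "snd p ` {..D} \<subseteq> S (fst p)" using p unfolding T_def S_def by auto
    moreover have "card (snd p ` {..D}) \<le> card (S (fst p))"
      by (rule card_mono[OF fin(1)]) fact
    ultimately show "snd p ` {..D} = S (fst p)" "card (S (fst p)) = Suc D"
      using fin[of "fst p"] card_subset_eq[of "S (fst p)" "snd p ` {..D}"] by auto
  qed
  have "inj_on fst T"
  proof (rule inj_onI)
    fix p q assume pq: "p \<in> T" "q \<in> T" "fst p = fst q"
    have "snd p i = snd q i" for i
    proof (cases "i \<le> D")
      case True
      show ?thesis
        by (rule strict_increasing_enumeration_unique[OF _ _ _ True]) (use pq enum in \<open>auto simp: T_def\<close>)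
    qed (use pq in \<open>auto simp: T_def\<close>)
    then show "p = q" using pq(3) by (auto simp: prod_eq_iff)
  qed
  then have "fst ` T \<in> sets borel"
    using T by (intro lusin_souslin) auto
  moreover have fstT: "fst ` T = {x. card (S x) = Suc D}"
  proof (intro equalityI subsetI)
    fix x assume "x \<in> {x. card (S x) = Suc D}"
    then have c: "card (S x) = Suc D" by simp
    define l where "l = sorted_list_of_set (S x)"
    have l: "length l = Suc D" "sorted_wrt (<) l" "set l = S x"
      unfolding l_def using c fin[of x] by auto
    have "(x, \<lambda>i. if i \<le> D then l ! i else 0) \<in> T"
      unfolding T_def using l(1,2) l(3) nth_mem[of _ l]
      by (auto simp: sorted_wrt_nth_less S_def less_Suc_eq_le)
    then show "x \<in> fst ` T" by force
  qed (use enum in auto)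
  ultimately have P: "{x. card (S x) = Suc D} \<in> sets borel" by simp
  define E' where "E' = E - fst -` {x. card (S x) = Suc D}"
  have "fst \<in> borel_measurable (borel :: ('a \<times> real) measure)"
    by (intro borel_measurable_continuous_onI continuous_intros)
  then have "(fst :: 'a \<times> real \<Rightarrow> 'a) -` {x. card (S x) = Suc D} \<in> sets borel"
    using measurable_sets[OF _ P] by fastforce
  then have "E' \<in> sets borel" unfolding E'_def using Suc.prems(1) by auto
  moreover have "finite {y. (x, y) \<in> E'} \<and> card {y. (x, y) \<in> E'} \<le> D" for x
  proof (cases "card (S x) = Suc D")
    case False
    then have "{y. (x, y) \<in> E'} = S x" unfolding E'_def S_def by auto
    then show ?thesis using fin[of x] False by simp
  qed (simp add: E'_def)
  ultimately have "fst ` E' \<in> sets borel" by (rule Suc.IH)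
  moreover have "fst ` E = fst ` E' \<union> {x. card (S x) = Suc D}"
  proof (intro equalityI subsetI)
    fix x assume "x \<in> fst ` E' \<union> {x. card (S x) = Suc D}"
    then consider "x \<in> fst ` E'" | "S x \<noteq> {}" by fastforce
    then show "x \<in> fst ` E" unfolding E'_def S_def by cases force+
  qed (force simp: E'_def)
  ultimately show ?case using P by simp
qed

text \<open>The bounded case of the Lusin--Novikov theorem.\<close>

lemma borel_bounded_sections_graphs:
  fixes E :: "(real \<times> real) set"
  assumes "E \<in> sets borel" "\<And>x. finite {y. (x, y) \<in> E} \<and> card {y. (x, y) \<in> E} \<le> D"
  shows "\<exists>G :: nat \<Rightarrow> (real \<times> real) set. (\<forall>i<D. G i \<in> sets borel \<and> single_valued (G i)) \<and> E = (\<Union>i<D. G i)"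
  using assms
proof (induction D arbitrary: E)
  case 0
  then have "{y. (x, y) \<in> E} = {}" for x by (metis card_0_eq le_zero_eq)
  then have "E = {}" by auto
  then show ?case by simp
next
  case (Suc D)
  \<comment> \<open>Each section is thinned by its least element.\<close>
  define H where "H = {q :: (real \<times> real) \<times> real. fst q \<in> E \<and> (fst (fst q), snd q) \<in> E \<and> snd q < snd (fst q)}"
  define L where "L = E - fst ` H"
  have fin: "finite {y. (x, y) \<in> E}" for x using Suc.prems by blast
  have "(\<lambda>q::(real \<times> real) \<times> real. (fst (fst q), snd q)) \<in> borel_measurable borel"
    "(\<lambda>q::(real \<times> real) \<times> real. fst q) \<in> borel_measurable borel"
    by (intro borel_measurable_continuous_onI continuous_intros)+
  then have [measurable]: "Measurable.pred borel (\<lambda>q::(real \<times> real) \<times> real. (fst (fst q), snd q) \<in> E)"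
     "Measurable.pred borel (\<lambda>q::(real \<times> real) \<times> real. fst q \<in> E)"
    using Suc.prems(1) by (auto intro: pred_sets2)
  have [measurable]: "(\<lambda>q::(real \<times> real) \<times> real. snd (fst q)) \<in> borel_measurable borel"
    "(\<lambda>q::(real \<times> real) \<times> real. snd q) \<in> borel_measurable borel"
    by (intro borel_measurable_continuous_onI continuous_intros)+
  have "H = {q \<in> space borel. fst q \<in> E \<and> (fst (fst q), snd q) \<in> E \<and> snd q < snd (fst q)}"
    unfolding H_def by simp
  also have "\<dots> \<in> sets borel" by measurable
  finally have "H \<in> sets borel" .
  \<comment> \<open>A point of \<open>H\<close> is a pair of \<open>E\<close> with a smaller element
    of its section, so the pairs that are not least form a projection with bounded sections.\<close>
  moreover have "finite {y. (p, y) \<in> H} \<and> card {y. (p, y) \<in> H} \<le> Suc D" for p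
  proof -
    have "{y. (p, y) \<in> H} \<subseteq> {y. (fst p, y) \<in> E}" unfolding H_def by auto
    then show ?thesis using Suc.prems(2)[of "fst p"]
      by (meson card_mono finite_subset le_trans)
  qed
  ultimately have "fst ` H \<in> sets borel" by (rule borel_fst_image_bounded_sections)
  then have L: "L \<in> sets borel" unfolding L_def using Suc.prems(1) by auto
  have Lmin: "(x, y) \<in> L \<longleftrightarrow> (x, y) \<in> E \<and> (\<forall>z. (x, z) \<in> E \<longrightarrow> y \<le> z)" for x y
    unfolding L_def H_def by (force simp: not_less image_iff)
  have "single_valued L" unfolding single_valued_def using Lmin by (meson order_antisym)
  have "finite {y. (x, y) \<in> E - L} \<and> card {y. (x, y) \<in> E - L} \<le> D" for x
  proof (cases "{y. (x, y) \<in> E} = {}")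
    case True
    then have "{y. (x, y) \<in> E - L} = {}" by blast
    then show ?thesis by (metis card.empty finite.emptyI zero_le)
  next
    case False
    define m where "m = Min {y. (x, y) \<in> E}"
    have "m \<in> {y. (x, y) \<in> E}" unfolding m_def using Min_in[OF fin False] .
    moreover have "m \<notin> {y. (x, y) \<in> E - L}"
      using Lmin[of x m] calculation Min_le[OF fin] unfolding m_def by auto
    ultimately have "{y. (x, y) \<in> E - L} \<subset> {y. (x, y) \<in> E}" by blast
    then have "card {y. (x, y) \<in> E - L} < card {y. (x, y) \<in> E}" by (rule psubset_card_mono[OF fin])
    moreover have "finite {y. (x, y) \<in> E - L}" by (rule finite_subset[OF _ fin[of x]]) auto
    ultimately show ?thesis using Suc.prems(2)[of x] by simp
  qed
  moreover have "E - L \<in> sets borel" using L Suc.prems(1) by auto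
  ultimately have "\<exists>G :: nat \<Rightarrow> (real \<times> real) set.
      (\<forall>i<D. G i \<in> sets borel \<and> single_valued (G i)) \<and> E - L = (\<Union>i<D. G i)"
    by (rule Suc.IH[rotated])
  then obtain G :: "nat \<Rightarrow> (real \<times> real) set" where
    G: "\<forall>i<D. G i \<in> sets borel \<and> single_valued (G i)" "E - L = (\<Union>i<D. G i)" by blast
  have "E = (\<Union>i<Suc D. (G(D := L)) i)"
  proof -
    have "(\<Union>i<Suc D. (G(D := L)) i) = L \<union> (\<Union>i<D. G i)" by (auto simp: lessThan_Suc)
    then show ?thesis using G(2) L_def by auto
  qed
  then show ?case using G(1) L \<open>single_valued L\<close>
    by (intro exI[of _ "G(D := L)"]) (simp add: less_Suc_eq)
qed

section \<open>Transfer from the reals to the node space\<close>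

lemma sets_pair_real_coding:
  fixes M :: "'a measure"
  assumes inj: "inj_on \<rho> (space M)" and \<rho>: "\<And>A. A \<subseteq> space M \<Longrightarrow> A \<in> sets M \<longleftrightarrow> \<rho> ` A \<in> sets borel"
    and E: "E \<in> sets (M \<Otimes>\<^sub>M M)"
  shows "map_prod \<rho> \<rho> ` E \<in> sets (borel :: (real \<times> real) measure)"
proof (cases "space M = {}")
  case True
  then have "E = {}" using sets.sets_into_space[OF E] by (simp add: space_pair_measure)
  then show ?thesis by simp
next
  case False
  then obtain x0 where x0: "x0 \<in> space M" by blast
  \<comment> \<open>The inverse of the coding, made total by the default \<open>x0\<close>; the set
    in question is then a preimage under two copies of \<open>g\<close>, cut down to the coded
    pairs.\<close>
  define g where "g = (\<lambda>t. if t \<in> \<rho> ` space M then inv_into (space M) \<rho> t else x0)"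
  have X: "\<rho> ` space M \<in> sets borel" using \<rho>[of "space M"] by simp
  have g: "g \<in> measurable borel M"
  proof (rule measurableI)
    show "g t \<in> space M" for t unfolding g_def using x0 inv_into_into[of t \<rho> "space M"] by auto
    fix A assume A: "A \<in> sets M"
    then have "A \<subseteq> space M" by (rule sets.sets_into_space)
    then have "g -` A \<inter> space borel = \<rho> ` A \<union> (if x0 \<in> A then - \<rho> ` space M else {})"
      unfolding g_def using inj by (auto simp: inv_into_f_f subset_iff dest: inj_onD split: if_splits)
    then show "g -` A \<inter> space borel \<in> sets borel" using \<rho>[OF \<open>A \<subseteq> space M\<close>] A X by auto
  qed
  have "(\<lambda>p. (g (fst p), g (snd p))) \<in> measurable (borel \<Otimes>\<^sub>M borel) (M \<Otimes>\<^sub>M M)" using g by measurable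
  then have "(\<lambda>p. (g (fst p), g (snd p))) -` E \<inter> space (borel \<Otimes>\<^sub>M borel) \<in> sets (borel \<Otimes>\<^sub>M borel)"
    using E by (rule measurable_sets)
  moreover have "\<rho> ` space M \<times> \<rho> ` space M \<in> sets (borel \<Otimes>\<^sub>M borel)" using X by auto
  ultimately have "(\<lambda>p. (g (fst p), g (snd p))) -` E \<inter> (\<rho> ` space M \<times> \<rho> ` space M) \<in> sets (borel \<Otimes>\<^sub>M borel)"
    by (intro sets.Int) (simp_all add: space_pair_measure)
  then have "(\<lambda>p. (g (fst p), g (snd p))) -` E \<inter> (\<rho> ` space M \<times> \<rho> ` space M) \<in> sets borel"
    by (simp only: borel_prod)
  moreover have "map_prod \<rho> \<rho> ` E = (\<lambda>p. (g (fst p), g (snd p))) -` E \<inter> (\<rho> ` space M \<times> \<rho> ` space M)"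
  proof -
    have sub: "E \<subseteq> space M \<times> space M" using sets.sets_into_space[OF E] by (simp add: space_pair_measure)
    have "g (\<rho> x) = x" if "x \<in> space M" for x unfolding g_def using that inj by simp
    then show ?thesis using sub by (fastforce simp: image_iff)
  qed
  ultimately show ?thesis by simp
qed

text \<open>The partial functions with graphs \<open>G i\<close> are pulled back along the coding
  and made total by \<open>f i x = x\<close>. The default is harmless, because in an irreflexive
  graph a fixed point never stands for an edge.\<close>

theorem bounded_degree_neighbour_functions:
  fixes M :: "'a measure"
  assumes "standard_borel M" and E: "E \<in> sets (M \<Otimes>\<^sub>M M)"
    and deg: "\<And>x. x \<in> space M \<Longrightarrow> finite {y \<in> space M. (x, y) \<in> E} \<and> card {y \<in> space M. (x, y) \<in> E} \<le> D"
  obtains f :: "nat \<Rightarrow> 'a \<Rightarrow> 'a" where "\<And>i. f i \<in> measurable M M"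
    "\<And>x y. (x, y) \<in> E \<Longrightarrow> \<exists>i<D. y = f i x"
    "\<And>x i. x \<in> space M \<Longrightarrow> f i x = x \<or> (x, f i x) \<in> E"
proof (cases "space M = {}")
  case True
  then have "E = {}" using sets.sets_into_space[OF E] by (simp add: space_pair_measure)
  then show ?thesis using True by (intro that[of "\<lambda>i x. x"]) auto
next
  case False
  then obtain \<rho> :: "'a \<Rightarrow> real" where inj: "inj_on \<rho> (space M)"
    and \<rho>: "\<And>A. A \<subseteq> space M \<Longrightarrow> A \<in> sets M \<longleftrightarrow> \<rho> ` A \<in> sets borel"
    using standard_borel_real_coding[OF assms(1)] by blast
  have sub: "E \<subseteq> space M \<times> space M" using sets.sets_into_space[OF E] by (simp add: space_pair_measure)
  define E' where "E' = map_prod \<rho> \<rho> ` E"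
  have "E' \<in> sets borel" unfolding E'_def using sets_pair_real_coding[OF inj \<rho> E] .
  moreover have "finite {y. (x, y) \<in> E'} \<and> card {y. (x, y) \<in> E'} \<le> D" for x
  proof (cases "x \<in> \<rho> ` space M")
    case True
    then obtain a where a: "a \<in> space M" "x = \<rho> a" by blast
    have "{y. (x, y) \<in> E'} = \<rho> ` {y \<in> space M. (a, y) \<in> E}"
      using a sub inj unfolding E'_def by (auto dest: inj_onD)
    then show ?thesis
      using deg[OF a(1)] card_image_le[of "{y \<in> space M. (a, y) \<in> E}" \<rho>] by simp
  next
    case False
    then have "{y. (x, y) \<in> E'} = {}" using sub unfolding E'_def by auto
    then show ?thesis by simp
  qed
  ultimately obtain G :: "nat \<Rightarrow> (real \<times> real) set"
    where G: "\<And>i. i < D \<Longrightarrow> G i \<in> sets borel" "\<And>i. i < D \<Longrightarrow> single_valued (G i)" "E' = (\<Union>i<D. G i)"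
    using borel_bounded_sections_graphs[of E' D] by blast
  define R where "R = (\<lambda>i x y. i < D \<and> y \<in> space M \<and> (\<rho> x, \<rho> y) \<in> G i)"
  define f where "f = (\<lambda>i x. if \<exists>y. R i x y then (THE y. R i x y) else x)"
  have R: "f i x = y" if y: "R i x y" for i x y
  proof -
    have "z = y" if "R i x z" for z
      using y that G(2)[of i] inj unfolding R_def single_valued_def by (meson inj_onD)
    with y have "(THE y. R i x y) = y" by (rule the_equality)
    then show ?thesis unfolding f_def using y by metis
  qed
  have RE: "(x, y) \<in> E" if "R i x y" "x \<in> space M" for i x y
  proof -
    have "(\<rho> x, \<rho> y) \<in> E'" "y \<in> space M" using that(1) G(3) unfolding R_def by auto
    then obtain a b where "(a, b) \<in> E" "\<rho> x = \<rho> a" "\<rho> y = \<rho> b" unfolding E'_def by auto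
    moreover have "a = x" "b = y"
      using calculation that(2) \<open>y \<in> space M\<close> sub inj_onD[OF inj, of x a] inj_onD[OF inj, of y b] by auto
    ultimately show ?thesis by simp
  qed
  show ?thesis
  proof
    show "f i x = x \<or> (x, f i x) \<in> E" if "x \<in> space M" for x i
    proof (cases "\<exists>y. R i x y")
      case True
      then obtain y where "R i x y" by blast
      then show ?thesis using R[of i x y] RE[of i x y] that by simp
    next
      case False
      then have "f i x = x" unfolding f_def by (rule if_not_P)
      then show ?thesis ..
    qed
    show "\<exists>i<D. y = f i x" if "(x, y) \<in> E" for x y
    proof -
      have "(\<rho> x, \<rho> y) \<in> E'" unfolding E'_def using that by force
      then obtain i where "i < D" "(\<rho> x, \<rho> y) \<in> G i" using G(3) by blast
      then have "R i x y" unfolding R_def using that sub by auto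
      then show ?thesis using R \<open>i < D\<close> by blast
    qed
    show "f i \<in> measurable M M" for i
    proof (cases "i < D")
      case False
      then have "f i = (\<lambda>x. x)" unfolding f_def R_def by auto
      then show ?thesis by simp
    next
      case True
      \<comment> \<open>The part of \<open>G i\<close> over \<open>A\<close> is the graph of a
        partial function, so its first projection is injective and the Lusin--Souslin theorem
        applies.\<close>
      have dom: "{x \<in> space M. \<exists>y\<in>A. R i x y} \<in> sets M" if A: "A \<in> sets M" for A
      proof -
        have As: "A \<subseteq> space M" using A by (rule sets.sets_into_space)
        have "snd \<in> borel_measurable (borel :: (real \<times> real) measure)"
          by (intro borel_measurable_continuous_onI continuous_intros)
        then have "(snd :: real \<times> real \<Rightarrow> real) -` \<rho> ` A \<in> sets borel"
          using measurable_sets[of snd borel borel "\<rho> ` A"] \<rho>[OF As] A by simp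
        then have "G i \<inter> snd -` \<rho> ` A \<in> sets borel" using G(1)[OF True] by auto
        moreover have "inj_on fst (G i \<inter> snd -` \<rho> ` A)"
          using G(2)[OF True] unfolding single_valued_def inj_on_def by (auto simp: prod_eq_iff)
        ultimately have "fst ` (G i \<inter> snd -` \<rho> ` A) \<in> sets borel"
          by (intro lusin_souslin) (auto intro!: borel_measurable_continuous_onI continuous_intros)
        moreover have "fst ` (G i \<inter> snd -` \<rho> ` A) = \<rho> ` {x \<in> space M. \<exists>y\<in>A. R i x y}"
        proof (intro equalityI subsetI)
          fix t assume "t \<in> fst ` (G i \<inter> snd -` \<rho> ` A)"
          then obtain y where y: "y \<in> A" "(t, \<rho> y) \<in> G i" by auto
          then have "(t, \<rho> y) \<in> E'" using G(3) True by blast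
          then obtain x where "x \<in> space M" "t = \<rho> x" using sub unfolding E'_def by auto
          then show "t \<in> \<rho> ` {x \<in> space M. \<exists>y\<in>A. R i x y}"
            using y As True unfolding R_def by auto
        qed (force simp: R_def)
        ultimately show ?thesis using \<rho>[of "{x \<in> space M. \<exists>y\<in>A. R i x y}"] by auto
      qed
      show ?thesis
      proof (rule measurableI)
        show "f i x \<in> space M" if "x \<in> space M" for x
        proof (cases "\<exists>y. R i x y")
          case True
          then obtain y where "R i x y" by blast
          then show ?thesis using R[of i x y] by (simp add: R_def)
        next
          case False
          then have "f i x = x" unfolding f_def by (rule if_not_P)
          then show ?thesis using that by simp
        qed
        fix A assume A: "A \<in> sets M"
        have eq: "f i -` A \<inter> space M = {x \<in> space M. \<exists>y\<in>A. R i x y} \<union> (A - {x \<in> space M. \<exists>y\<in>space M. R i x y})"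
        proof (intro equalityI subsetI)
          fix x assume "x \<in> f i -` A \<inter> space M"
          then show "x \<in> {x \<in> space M. \<exists>y\<in>A. R i x y} \<union> (A - {x \<in> space M. \<exists>y\<in>space M. R i x y})"
          proof (cases "\<exists>y. R i x y")
            case True
            then obtain y where "R i x y" by blast
            then show ?thesis using \<open>x \<in> f i -` A \<inter> space M\<close> R[of i x y] by auto
          next
            case False
            then have "f i x = x" unfolding f_def by (rule if_not_P)
            then show ?thesis using \<open>x \<in> f i -` A \<inter> space M\<close> False by auto
          qed
        next
          fix x assume x: "x \<in> {x \<in> space M. \<exists>y\<in>A. R i x y} \<union> (A - {x \<in> space M. \<exists>y\<in>space M. R i x y})"
          then show "x \<in> f i -` A \<inter> space M"
          proof
            assume "x \<in> A - {x \<in> space M. \<exists>y\<in>space M. R i x y}"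
            then have "x \<in> A" "x \<in> space M" "\<not> (\<exists>y. R i x y)"
              using sets.sets_into_space[OF A] by (auto simp: R_def)
            then have "f i x = x" unfolding f_def by (intro if_not_P)
            then show ?thesis using \<open>x \<in> A\<close> \<open>x \<in> space M\<close> by simp
          next
            assume "x \<in> {x \<in> space M. \<exists>y\<in>A. R i x y}"
            then show ?thesis using R[of i x] by auto
          qed
        qed
        show "f i -` A \<inter> space M \<in> sets M" unfolding eq using dom[OF A] dom[OF sets.top] A by auto
      qed
    qed
  qed
qed

section \<open>Finite Borel colourings\<close>

definition words :: "nat \<Rightarrow> nat \<Rightarrow> nat list set" where
  "words D r = {w. set w \<subseteq> {..<D} \<and> length w \<le> r}"

lemma finite_words: "finite (words D r)"
  unfolding words_def by (rule finite_lists_length_le) simp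

lemma words_mono: "r \<le> s \<Longrightarrow> words D r \<subseteq> words D s"
  by (auto simp: words_def)

text \<open>What the coding needs from a graphing: \<open>f_reversible\<close> is the symmetry of
  the edge set, and \<open>U\<close> turns equality of nodes into countably many measurable
  conditions.\<close>

locale coded_action =
  fixes M :: "'a measure" and D :: nat and f :: "nat \<Rightarrow> 'a \<Rightarrow> 'a" and U :: "nat \<Rightarrow> 'a set"
  assumes f_measurable [measurable]: "\<And>i. f i \<in> measurable M M"
    and f_reversible: "\<And>x i. x \<in> space M \<Longrightarrow> i < D \<Longrightarrow> f i x \<noteq> x \<Longrightarrow> \<exists>j<D. f j (f i x) = x"
    and U_sets [measurable]: "\<And>n. U n \<in> sets M"
    and sets_U: "sets M = sigma_sets (space M) (range U)"
    and U_separating: "\<And>x y. x \<in> space M \<Longrightarrow> y \<in> space M \<Longrightarrow> x \<noteq> y \<Longrightarrow> \<exists>n. (x \<in> U n) \<noteq> (y \<in> U n)"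
begin

lemma fold_measurable [measurable]: "fold f w \<in> measurable M M"
proof (induction w)
  case (Cons i w)
  then show ?case using measurable_comp[OF f_measurable Cons.IH] by simp
qed (simp add: id_def)

lemma fold_space [simp]: "x \<in> space M \<Longrightarrow> fold f w x \<in> space M"
  by (rule measurable_space[OF fold_measurable])

lemma pred_fold_eq: "Measurable.pred M (\<lambda>x. fold f w x = fold f v x)"
proof -
  have "fold f w x = fold f v x \<longleftrightarrow> (\<forall>n. fold f w x \<in> U n \<longleftrightarrow> fold f v x \<in> U n)" if "x \<in> space M" for x
    using U_separating[of "fold f w x" "fold f v x"] that by auto
  moreover have "Measurable.pred M (\<lambda>x. \<forall>n. fold f w x \<in> U n \<longleftrightarrow> fold f v x \<in> U n)" by measurable
  ultimately show ?thesis
    using measurable_cong[of M "\<lambda>x. fold f w x = fold f v x" "\<lambda>x. \<forall>n. fold f w x \<in> U n \<longleftrightarrow> fold f v x \<in> U n"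
        "count_space UNIV"] by blast
qed

text \<open>Letters are undone in reverse order, and a letter that fixes its argument is dropped;
  hence only a bound on the length.\<close>

lemma word_reversible:
  assumes "x \<in> space M" "set w \<subseteq> {..<D}"
  shows "\<exists>v. set v \<subseteq> {..<D} \<and> length v \<le> length w \<and> fold f v (fold f w x) = x"
  using assms
proof (induction w arbitrary: x)
  case (Cons i w)
  have "f i x \<in> space M" using Cons.prems(1) measurable_space[OF f_measurable] by blast
  then obtain v where v: "set v \<subseteq> {..<D}" "length v \<le> length w" "fold f v (fold f w (f i x)) = f i x"
    using Cons.IH[of "f i x"] Cons.prems(2) by auto
  show ?case
  proof (cases "f i x = x")
    case True
    then show ?thesis using v by (intro exI[of _ v]) auto
  next
    case False
    then obtain j where "j < D" "f j (f i x) = x" using f_reversible[of x i] Cons.prems by auto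
    then show ?thesis using v by (intro exI[of _ "v @ [j]"]) auto
  qed
qed simp

text \<open>A node is coloured by its membership bits along the shortest initial segment of
  \<open>U\<close> that separates it from every other node reached by words of length at most
  \<open>r\<close>. Equal colours mean segments of equal length with equal bits, which contradicts
  the separation.\<close>

lemma countable_colouring:
  obtains c :: "'a \<Rightarrow> nat" where "c \<in> measurable M (count_space UNIV)"
    "\<And>x w. x \<in> space M \<Longrightarrow> w \<in> words D r \<Longrightarrow> fold f w x \<noteq> x \<Longrightarrow> c (fold f w x) \<noteq> c x"
proof -
  define W where "W = words D r"
  have fin: "finite W" unfolding W_def by (rule finite_words)
  define sep where "sep = (\<lambda>n x. \<forall>w\<in>W. fold f w x \<noteq> x \<longrightarrow> (\<exists>k<n. (fold f w x \<in> U k) \<noteq> (x \<in> U k)))"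
  define code where "code = (\<lambda>n x. map (\<lambda>k. x \<in> U k) [0..<n])"
  define q where "q = (\<lambda>x. LEAST n. sep n x)"
  define c where "c = (\<lambda>x. to_nat (code (q x) x))"
  have code: "code n \<in> measurable M (count_space UNIV)" for n
  proof (induction n)
    case (Suc n)
    have "(\<lambda>x. l @ [x \<in> U n]) \<in> measurable M (count_space UNIV)" for l
    proof -
      have "(\<lambda>x. l @ [x \<in> U n]) = (\<lambda>b. l @ [b]) \<circ> (\<lambda>x. x \<in> U n)" by auto
      moreover have "(\<lambda>x. x \<in> U n) \<in> measurable M (count_space UNIV)" by measurable
      ultimately show ?thesis by (metis measurable_comp measurable_count_space)
    qed
    then have "(\<lambda>x. code n x @ [x \<in> U n]) \<in> measurable M (count_space UNIV)"
      by (rule measurable_compose_countable[OF _ Suc.IH])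
    then show ?case unfolding code_def by simp
  qed (simp add: code_def)
  have "Measurable.pred M (\<lambda>x. fold f w x = x)" for w using pred_fold_eq[of w "[]"] by simp
  then have "Measurable.pred M (\<lambda>x. sep n x)" for n unfolding sep_def using fin by measurable
  then have q: "q \<in> measurable M (count_space UNIV)" unfolding q_def by (rule measurable_Least)
  have "(\<lambda>x. code (q x) x) \<in> measurable M (count_space UNIV)"
    by (rule measurable_compose_countable[OF code q])
  then have "c \<in> measurable M (count_space UNIV)"
    unfolding c_def by (rule measurable_compose) simp
  moreover have "c (fold f w x) \<noteq> c x" if x: "x \<in> space M" "w \<in> words D r" "fold f w x \<noteq> x" for x w
  proof
    assume "c (fold f w x) = c x"
    then have eq: "code (q (fold f w x)) (fold f w x) = code (q x) x" unfolding c_def by simp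
    then have "q (fold f w x) = q x" unfolding code_def by (metis length_map length_upt diff_zero)
    then have same: "(fold f w x \<in> U k) = (x \<in> U k)" if "k < q x" for k
      using eq that unfolding code_def by (simp add: map_eq_conv)
    have "\<exists>k. fold f v x \<noteq> x \<longrightarrow> (fold f v x \<in> U k) \<noteq> (x \<in> U k)" for v
      using U_separating[of "fold f v x" x] x(1) by auto
    then have "\<forall>v. \<exists>k. fold f v x \<noteq> x \<longrightarrow> (fold f v x \<in> U k) \<noteq> (x \<in> U k)" by blast
    then obtain k where k: "\<And>v. fold f v x \<noteq> x \<Longrightarrow> (fold f v x \<in> U (k v)) \<noteq> (x \<in> U (k v))" by metis
    have "k v < Suc (Max (k ` W))" if "v \<in> W" for v using fin that by (simp add: less_Suc_eq_le)
    then have "sep (Suc (Max (k ` W))) x" unfolding sep_def using k by blast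
    then have "sep (q x) x" unfolding q_def by (rule LeastI)
    then show False using same x(2,3) unfolding sep_def W_def by blast
  qed
  ultimately show ?thesis by (rule that)
qed

text \<open>Since \<open>c\<close> is proper, all nodes of one class can be recoloured at the same
  time; each has at most \<open>card W\<close> relevant neighbours, so the colours up to
  \<open>card W\<close> suffice.\<close>

lemma finite_colouring:
  obtains c :: "'a \<Rightarrow> nat" and N where "c \<in> measurable M (count_space UNIV)" "\<And>x. c x \<le> N"
    "\<And>x w. x \<in> space M \<Longrightarrow> w \<in> words D r \<Longrightarrow> fold f w x \<noteq> x \<Longrightarrow> c (fold f w x) \<noteq> c x"
proof -
  obtain c :: "'a \<Rightarrow> nat" where c [measurable]: "c \<in> measurable M (count_space UNIV)"
    and proper: "\<And>x w. x \<in> space M \<Longrightarrow> w \<in> words D r \<Longrightarrow> fold f w x \<noteq> x \<Longrightarrow> c (fold f w x) \<noteq> c x"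
    using countable_colouring[of r] by blast
  define W where "W = words D r"
  have fin: "finite W" unfolding W_def by (rule finite_words)
  \<comment> \<open>Greedy recolouring: stage \<open>n\<close> gives the \<open>c\<close>-class \<open>n\<close> the least colours not used by neighbours of smaller class.\<close>
  define col where "col = rec_nat (\<lambda>x. 0 :: nat) (\<lambda>n g x. if c x = n
      then (LEAST k. \<forall>w\<in>W. c (fold f w x) < n \<longrightarrow> g (fold f w x) \<noteq> k) else g x)"
  have col_Suc: "col (Suc n) x = (if c x = n
      then (LEAST k. \<forall>w\<in>W. c (fold f w x) < n \<longrightarrow> col n (fold f w x) \<noteq> k) else col n x)" for n x
    unfolding col_def by simp
  have col_meas: "col n \<in> measurable M (count_space UNIV)" for n
  proof (induction n)
    case (Suc n)
    note Suc.IH [measurable]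
    have "Measurable.pred M (\<lambda>x. \<forall>w\<in>W. c (fold f w x) < n \<longrightarrow> col n (fold f w x) \<noteq> k)" for k
      using fin by measurable
    then have "(\<lambda>x. LEAST k. \<forall>w\<in>W. c (fold f w x) < n \<longrightarrow> col n (fold f w x) \<noteq> k) \<in> measurable M (count_space UNIV)"
      by (rule measurable_Least)
    then have "(\<lambda>x. if c x = n then (LEAST k. \<forall>w\<in>W. c (fold f w x) < n \<longrightarrow> col n (fold f w x) \<noteq> k) else col n x)
        \<in> measurable M (count_space UNIV)"
      by measurable
    then show ?case unfolding col_Suc[abs_def] .
  qed (simp add: col_def)
  \<comment> \<open>The colour just after the stage of the node's own class; later stages leave it
    alone, which yields the recursion \<open>c'_eq\<close>.\<close>
  define c' where "c' = (\<lambda>x. col (Suc (c x)) x)"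
  have col_c': "col n x = c' x" if "c x < n" for n x
    using that by (induction n) (auto simp: col_Suc c'_def less_Suc_eq)
  have c'_eq: "c' x = (LEAST k. \<forall>w\<in>W. c (fold f w x) < c x \<longrightarrow> c' (fold f w x) \<noteq> k)" for x
  proof -
    have "c' x = col (Suc (c x)) x" by (simp add: c'_def)
    also have "\<dots> = (LEAST k. \<forall>w\<in>W. c (fold f w x) < c x \<longrightarrow> c' (fold f w x) \<noteq> k)"
      by (simp add: col_Suc col_c' cong: imp_cong)
    finally show ?thesis .
  qed
  have free: "\<exists>k\<le>card W. \<forall>w\<in>W. c' (fold f w x) \<noteq> k" for x
  proof (rule ccontr)
    assume "\<not> ?thesis"
    then have "{..card W} \<subseteq> (\<lambda>w. c' (fold f w x)) ` W" by auto
    then have "card {..card W} \<le> card W" using fin by (meson card_image_le card_mono finite_imageI le_trans)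
    then show False by simp
  qed
  have avoid: "\<forall>w\<in>W. c (fold f w x) < c x \<longrightarrow> c' (fold f w x) \<noteq> c' x" for x
  proof -
    obtain k where "\<forall>w\<in>W. c (fold f w x) < c x \<longrightarrow> c' (fold f w x) \<noteq> k" using free by blast
    then show ?thesis unfolding c'_eq[of x] by (rule LeastI)
  qed
  show ?thesis
  proof
    show "c' \<in> measurable M (count_space UNIV)"
      unfolding c'_def by (rule measurable_compose_countable[OF col_meas]) measurable
    show "c' x \<le> card W" for x
    proof -
      obtain k where k: "k \<le> card W" "\<forall>w\<in>W. c (fold f w x) < c x \<longrightarrow> c' (fold f w x) \<noteq> k" using free by blast
      have "c' x \<le> k" unfolding c'_eq[of x] using k(2) by (rule Least_le)
      then show ?thesis using k(1) by simp
    qed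
    fix x w assume x: "x \<in> space M" "w \<in> words D r" "fold f w x \<noteq> x"
    \<comment> \<open>If the other endpoint has the larger class, the greedy condition is applied
      there, so a word leading back to \<open>x\<close> must belong to \<open>W\<close>.\<close>
    obtain v where v: "set v \<subseteq> {..<D}" "length v \<le> length w" "fold f v (fold f w x) = x"
      using word_reversible[OF x(1), of w] x(2) unfolding words_def by auto
    then have "v \<in> W" using x(2) unfolding W_def words_def by auto
    have "c (fold f w x) \<noteq> c x" by (rule proper[OF x])
    then consider "c (fold f w x) < c x" | "c x < c (fold f w x)" by linarith
    then show "c' (fold f w x) \<noteq> c' x"
    proof cases
      case 1
      then show ?thesis using avoid[of x] x(2) unfolding W_def by blast
    next
      case 2
      then show ?thesis using avoid[of "fold f w x"] \<open>v \<in> W\<close> v(3) by force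
    qed
  qed
qed

end

section \<open>Compact metrics from labels in a Cantor space\<close>

definition agree :: "nat \<Rightarrow> ('i::countable \<Rightarrow> bool) \<Rightarrow> ('i \<Rightarrow> bool) \<Rightarrow> bool" where
  "agree n a b \<longleftrightarrow> (\<forall>i. to_nat i < n \<longrightarrow> a i = b i)"

lemma agree_refl [simp]: "agree n a a"
  and agree_sym: "agree n a b \<Longrightarrow> agree n b a"
  and agree_trans: "agree n a b \<Longrightarrow> agree n b c \<Longrightarrow> agree n a c"
  and agree_mono: "agree n a b \<Longrightarrow> m \<le> n \<Longrightarrow> agree m a b"
  by (auto simp: agree_def)

lemma finite_to_nat_less: "finite {i::'i::countable. to_nat i < n}"
proof -
  have "finite (to_nat -` {..<n} :: 'i set)" by (intro finite_vimageI) auto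
  then show ?thesis by (simp add: vimage_def)
qed

lemma agree_finite_set:
  fixes F :: "'i::countable set"
  assumes "finite F"
  obtains n where "\<And>a b. agree n a b \<Longrightarrow> \<forall>i\<in>F. a i = b i"
proof -
  have "to_nat i < Suc (Max (to_nat ` F))" if "i \<in> F" for i
    using assms that by (simp add: less_Suc_eq_le)
  then show ?thesis by (intro that[of "Suc (Max (to_nat ` F))"]) (auto simp: agree_def)
qed

definition cantor_dist :: "('i::countable \<Rightarrow> bool) \<Rightarrow> ('i \<Rightarrow> bool) \<Rightarrow> real" where
  "cantor_dist a b = (if a = b then 0 else inverse (real (Suc (LEAST n. \<exists>i. to_nat i = n \<and> a i \<noteq> b i))))"

text \<open>Closed balls of radius \<open>inverse (real (Suc n))\<close> are the sets of functions
  agreeing on the first \<open>n\<close> indices, so all metric statements turn into statements on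
  \<open>agree\<close>.\<close>

lemma cantor_dist_le_iff: "cantor_dist a b \<le> inverse (real (Suc n)) \<longleftrightarrow> agree n a b"
proof (cases "a = b")
  case False
  define k where "k = (LEAST n. \<exists>i. to_nat i = n \<and> a i \<noteq> b i)"
  obtain i0 where "a i0 \<noteq> b i0" using False by auto
  have "\<exists>n i. to_nat i = n \<and> a i \<noteq> b i" using \<open>a i0 \<noteq> b i0\<close> by blast
  then have "\<exists>i. to_nat i = k \<and> a i \<noteq> b i" unfolding k_def by (rule LeastI_ex)
  moreover have "k \<le> to_nat i" if "a i \<noteq> b i" for i unfolding k_def using that by (intro Least_le) blast
  ultimately have "n \<le> k \<longleftrightarrow> agree n a b" unfolding agree_def by (meson leD leI le_trans)
  moreover have "cantor_dist a b = inverse (real (Suc k))" using False unfolding cantor_dist_def k_def by simp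
  moreover have "inverse (real (Suc k)) \<le> inverse (real (Suc n)) \<longleftrightarrow> n \<le> k"
    by (subst inverse_le_iff_le) auto
  ultimately show ?thesis by simp
qed (simp add: cantor_dist_def)

lemma cantor_dist_cases:
  obtains "a = b" "cantor_dist a b = 0" | n where "a \<noteq> b" "cantor_dist a b = inverse (real (Suc n))" "agree n a b"
proof (cases "a = b")
  case False
  then obtain n where n: "cantor_dist a b = inverse (real (Suc n))" unfolding cantor_dist_def by auto
  then have "agree n a b" unfolding cantor_dist_le_iff[symmetric] by simp
  then show ?thesis using that False n by blast
qed (simp add: cantor_dist_def that)

lemma cantor_dist_nonneg: "0 \<le> cantor_dist a b"
  unfolding cantor_dist_def by auto

lemma cantor_dist_commute: "cantor_dist a b = cantor_dist b a"
proof -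
  have "(\<lambda>n. \<exists>i. to_nat i = n \<and> a i \<noteq> b i) = (\<lambda>n. \<exists>i. to_nat i = n \<and> b i \<noteq> a i)" by (metis (no_types))
  then show ?thesis unfolding cantor_dist_def by auto
qed

lemma cantor_dist_eq_0: "cantor_dist a b = 0 \<longleftrightarrow> a = b"
  unfolding cantor_dist_def by auto

text \<open>In fact an ultrametric, as \<open>agree n\<close> is transitive.\<close>

lemma cantor_dist_triangle: "cantor_dist a c \<le> cantor_dist a b + cantor_dist b c"
proof (cases a b rule: cantor_dist_cases)
  case (2 m)
  note m = this
  show ?thesis
  proof (cases b c rule: cantor_dist_cases)
    case (2 n)
    have "agree (min m n) a c"
      using m(3) 2(3) by (meson agree_mono agree_trans min.cobounded1 min.cobounded2)
    then have "cantor_dist a c \<le> inverse (real (Suc (min m n)))" by (simp only: cantor_dist_le_iff)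
    also have "\<dots> \<le> cantor_dist a b + cantor_dist b c"
      using m 2 by (cases "m \<le> n") (simp_all add: min_def)
    finally show ?thesis .
  qed simp
qed simp

text \<open>The Cantor metric is pulled back along a labelling because the nodes of the compact
  graphing live in a prescribed type instead of being functions. The second axiom says that the
  labels form a closed set.\<close>

locale labelled_cantor =
  fixes V :: "'v set" and l :: "'v \<Rightarrow> 'i::countable \<Rightarrow> bool"
  assumes label_inj: "inj_on l V"
    and label_closed: "\<And>a. (\<And>n. \<exists>p\<in>V. agree n a (l p)) \<Longrightarrow> \<exists>p\<in>V. l p = a"
begin

definition "ldist p q = cantor_dist (l p) (l q)"

sublocale Metric_space V ldist
proof
  show "ldist x y = 0 \<longleftrightarrow> x = y" if "x \<in> V" "y \<in> V" for x y
    unfolding ldist_def cantor_dist_eq_0 using that label_inj by (auto dest: inj_onD)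
qed (auto simp: ldist_def cantor_dist_nonneg cantor_dist_triangle intro: cantor_dist_commute)

lemma ldist_le_iff: "ldist p q \<le> inverse (real (Suc n)) \<longleftrightarrow> agree n (l p) (l q)"
  unfolding ldist_def by (rule cantor_dist_le_iff)

lemma ldist_less: "ldist p q < inverse (real (Suc n)) \<Longrightarrow> agree n (l p) (l q)"
  using ldist_le_iff by fastforce

lemma agree_ldist_less:
  assumes "e > 0"
  obtains n where "\<And>p q. agree n (l p) (l q) \<Longrightarrow> ldist p q < e"
proof -
  obtain n where n: "inverse (real (Suc n)) < e" using reals_Archimedean[OF assms] by auto
  show ?thesis
  proof
    fix p q assume "agree n (l p) (l q)"
    then have "ldist p q \<le> inverse (real (Suc n))" by (simp only: ldist_le_iff)
    then show "ldist p q < e" using n by simp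
  qed
qed

lemma openin_iff_agree:
  "openin mtopology X \<longleftrightarrow> X \<subseteq> V \<and> (\<forall>p\<in>X. \<exists>n. \<forall>q\<in>V. agree n (l p) (l q) \<longrightarrow> q \<in> X)"
proof -
  have "(\<exists>r>0. mball p r \<subseteq> X) \<longleftrightarrow> (\<exists>n. \<forall>q\<in>V. agree n (l p) (l q) \<longrightarrow> q \<in> X)" if "p \<in> V" for p
  proof
    assume "\<exists>r>0. mball p r \<subseteq> X"
    then obtain r where r: "r > 0" "mball p r \<subseteq> X" by blast
    obtain n where "\<And>p q. agree n (l p) (l q) \<Longrightarrow> ldist p q < r" using agree_ldist_less[OF r(1)] by blast
    then have "\<forall>q\<in>V. agree n (l p) (l q) \<longrightarrow> q \<in> X" using r(2) that by (auto simp: subset_iff)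
    then show "\<exists>n. \<forall>q\<in>V. agree n (l p) (l q) \<longrightarrow> q \<in> X" ..
  next
    assume "\<exists>n. \<forall>q\<in>V. agree n (l p) (l q) \<longrightarrow> q \<in> X"
    then obtain n where "\<forall>q\<in>V. agree n (l p) (l q) \<longrightarrow> q \<in> X" by blast
    then have "mball p (inverse (real (Suc n))) \<subseteq> X" using ldist_less by (auto simp: subset_iff)
    moreover have "inverse (real (Suc n)) > 0" by simp
    ultimately show "\<exists>r>0. mball p r \<subseteq> X" by blast
  qed
  then show ?thesis unfolding openin_mtopology by (auto simp: subset_iff)
qed

lemma mcomplete_labels: mcomplete
  unfolding mcomplete_def
proof (intro allI impI)
  fix s assume s: "MCauchy s"
  then have sV: "s k \<in> V" for k unfolding MCauchy_def by auto
  have "\<exists>K. \<forall>j k. K \<le> j \<longrightarrow> K \<le> k \<longrightarrow> agree n (l (s j)) (l (s k))" for n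
  proof -
    have "inverse (real (Suc n)) > 0" by simp
    then obtain K where "\<forall>j k. K \<le> j \<longrightarrow> K \<le> k \<longrightarrow> ldist (s j) (s k) < inverse (real (Suc n))"
      using s unfolding MCauchy_def by blast
    then show ?thesis using ldist_less by blast
  qed
  then obtain K where K: "\<And>n j k. K n \<le> j \<Longrightarrow> K n \<le> k \<Longrightarrow> agree n (l (s j)) (l (s k))" by metis
  \<comment> \<open>Bit \<open>i\<close> is read at a stage from which the first
    \<open>to_nat i + 1\<close> bits, and so bit \<open>i\<close> itself, no longer change.\<close>
  define a where "a = (\<lambda>i. l (s (K (Suc (to_nat i)))) i)"
  have a: "agree n a (l (s k))" if "K n \<le> k" for n k
    unfolding agree_def
  proof (intro allI impI)
    fix i :: 'i assume i: "to_nat i < n"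
    define m where "m = max k (K (Suc (to_nat i)))"
    have "agree n (l (s k)) (l (s m))" using that by (intro K) (auto simp: m_def)
    moreover have "agree (Suc (to_nat i)) (l (s (K (Suc (to_nat i))))) (l (s m))" by (intro K) (auto simp: m_def)
    ultimately show "a i = l (s k) i" using i unfolding agree_def a_def by auto
  qed
  then obtain p where p: "p \<in> V" "l p = a" using label_closed[of a] sV by blast
  have "\<exists>N. \<forall>k\<ge>N. s k \<in> V \<and> ldist (s k) p < e" if e: "e > 0" for e
  proof -
    obtain n where "\<And>p q. agree n (l p) (l q) \<Longrightarrow> ldist p q < e" using agree_ldist_less[OF e] by blast
    then show ?thesis using sV a p(2) by (metis agree_sym)
  qed
  then show "\<exists>x. limitin mtopology s x sequentially" using p(1) unfolding limit_metric_sequentially by blast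
qed

lemma mtotally_bounded_labels: "mtotally_bounded V"
  unfolding mtotally_bounded_def
proof (intro allI impI)
  fix e :: real assume "e > 0"
  then obtain n where n: "\<And>p q. agree n (l p) (l q) \<Longrightarrow> ldist p q < e" using agree_ldist_less by blast
  \<comment> \<open>Only finitely many patterns on the first \<open>n\<close> bits occur; one
    representative of each gives a finite net.\<close>
  define g where "g = (\<lambda>p. {i. to_nat i < n \<and> l p i})"
  have "g ` V \<subseteq> Pow {i. to_nat i < n}" unfolding g_def by auto
  then have fin: "finite (g ` V)" by (rule finite_subset) (simp add: finite_to_nat_less)
  define K where "K = inv_into V g ` g ` V"
  have "finite K" "K \<subseteq> V" unfolding K_def using fin by (auto intro: inv_into_into)
  moreover have "V \<subseteq> (\<Union>x\<in>K. mball x e)"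
  proof
    fix q assume q: "q \<in> V"
    define x where "x = inv_into V g (g q)"
    have x: "x \<in> K" "x \<in> V" "g x = g q"
      unfolding K_def x_def using q inv_into_into[of "g q" g V] by (simp_all add: f_inv_into_f)
    have "agree n (l x) (l q)" using x(3) unfolding agree_def g_def by blast
    then show "q \<in> (\<Union>x\<in>K. mball x e)" using n x q by (auto simp: in_mball)
  qed
  ultimately show "\<exists>K. finite K \<and> K \<subseteq> V \<and> V \<subseteq> (\<Union>x\<in>K. mball x e)" by blast
qed

lemma compact_space_labels: "compact_space mtopology"
  using compact_space_eq_mcomplete_mtotally_bounded mcomplete_labels mtotally_bounded_labels by blast

section \<open>Cylinders and the Borel sets of a labelled Cantor space\<close>

definition "cylinder n A = {p \<in> V. \<forall>i. to_nat i < n \<longrightarrow> (l p i \<longleftrightarrow> to_nat i \<in> A)}"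

text \<open>A pattern on the first \<open>n\<close> bits is encoded by a finite set of naturals, so
  that the cylinders form a countable base.\<close>

lemma mem_own_cylinder:
  assumes "p \<in> V"
  obtains A :: "nat set" where "finite A" "p \<in> cylinder n A" "cylinder n A = {q \<in> V. agree n (l p) (l q)}"
proof
  show "finite (to_nat ` {i. to_nat i < n \<and> l p i})"
    by (intro finite_imageI finite_subset[OF _ finite_to_nat_less[of n]]) auto
  show "cylinder n (to_nat ` {i. to_nat i < n \<and> l p i}) = {q \<in> V. agree n (l p) (l q)}"
    unfolding cylinder_def agree_def by auto
  then show "p \<in> cylinder n (to_nat ` {i. to_nat i < n \<and> l p i})" using assms by simp
qed

lemma countable_cylinders: "countable {(n::nat, A::nat set). finite A}"
proof -
  have "countable ((UNIV :: nat set) \<times> {A::nat set. finite A})" by (intro countable_SIGMA countable_Collect_finite countableI_type)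
  then show ?thesis by (rule countable_subset[rotated]) auto
qed

lemma separable_labels: "separable_space mtopology"
proof -
  define C where "C = (\<lambda>(n, A). SOME p. p \<in> cylinder n A) ` {(n, A). finite A \<and> cylinder n A \<noteq> {}}"
  have some: "(SOME p. p \<in> cylinder n A) \<in> cylinder n A" if "cylinder n A \<noteq> {}" for n A
    using that by (rule some_in_eq[THEN iffD2])
  have "countable {(n::nat, A::nat set). finite A \<and> cylinder n A \<noteq> {}}"
    by (rule countable_subset[OF _ countable_cylinders]) auto
  then have "countable C" unfolding C_def by (rule countable_image)
  moreover have "C \<subseteq> V"
  proof
    fix y assume "y \<in> C"
    then obtain n A where "y = (SOME p. p \<in> cylinder n A)" "cylinder n A \<noteq> {}"
      unfolding C_def by (auto simp del: ex_in_conv)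
    then have "y \<in> cylinder n A" using some by simp
    then show "y \<in> V" unfolding cylinder_def by simp
  qed
  moreover have "mtopology closure_of C = V"
  proof (intro equalityI subsetI)
    fix p assume p: "p \<in> V"
    have "\<exists>y\<in>C. y \<in> mball p r" if r: "r > 0" for r
    proof -
      obtain n where n: "\<And>p q. agree n (l p) (l q) \<Longrightarrow> ldist p q < r" using agree_ldist_less[OF r] by blast
      obtain A where A: "finite A" "p \<in> cylinder n A" "cylinder n A = {q \<in> V. agree n (l p) (l q)}"
        using mem_own_cylinder[OF p, of n] by blast
      define y where "y = (SOME p. p \<in> cylinder n A)"
      have "(n, A) \<in> {(n, A). finite A \<and> cylinder n A \<noteq> {}}" using A(1,2) by blast
      then have "y \<in> C" unfolding C_def y_def by (rule rev_image_eqI) simp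
      moreover have "y \<in> cylinder n A" unfolding y_def using some[of n A] A(2) by blast
      then have "y \<in> mball p r" unfolding A(3) using n p by (simp add: in_mball)
      ultimately show ?thesis by blast
    qed
    then show "p \<in> mtopology closure_of C" using p unfolding metric_closure_of by blast
  qed (auto simp: metric_closure_of)
  ultimately show ?thesis unfolding separable_space_def by auto
qed

abbreviation "B \<equiv> borel_of mtopology"

lemma space_B: "space B = V" by simp

lemma standard_borel_B: "standard_borel B"
  unfolding standard_borel_def completely_metrizable_space_def
  using Metric_space_axioms mcomplete_labels separable_labels by blast

text \<open>Every open set is a countable union of cylinders, and a cylinder restricts finitely many
  bits. Measurability into the compact space can therefore be checked bit by bit.\<close>

lemma sets_B: "sets B = sigma_sets V (range (\<lambda>i. {p \<in> V. l p i}))"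
proof
  define S where "S = sigma V (range (\<lambda>i. {p \<in> V. l p i}))"
  have S: "sets S = sigma_sets V (range (\<lambda>i. {p \<in> V. l p i}))" and space: "space S = V"
    unfolding S_def by (auto intro!: sets_measure_of space_measure_of)
  have [measurable]: "Measurable.pred S (\<lambda>p. l p i)" for i
    unfolding pred_def space S by auto
  have cyl: "cylinder n A \<in> sets S" for n A
  proof -
    have "{p \<in> space S. \<forall>i. to_nat i < n \<longrightarrow> (l p i \<longleftrightarrow> to_nat i \<in> A)} \<in> sets S" by measurable
    then show ?thesis unfolding cylinder_def space .
  qed
  have "X \<in> sets S" if X: "openin mtopology X" for X
  proof -
    have "X = (\<Union>(n, A) \<in> {(n, A). finite A \<and> cylinder n A \<subseteq> X}. cylinder n A)"
    proof (intro equalityI subsetI)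
      fix p assume p: "p \<in> X"
      then obtain n where "p \<in> V" "\<forall>q\<in>V. agree n (l p) (l q) \<longrightarrow> q \<in> X"
        using X unfolding openin_iff_agree by blast
      moreover obtain A where "finite A" "p \<in> cylinder n A" "cylinder n A = {q \<in> V. agree n (l p) (l q)}"
        using mem_own_cylinder[OF \<open>p \<in> V\<close>, of n] by blast
      ultimately show "p \<in> (\<Union>(n, A) \<in> {(n, A). finite A \<and> cylinder n A \<subseteq> X}. cylinder n A)" by blast
    qed auto
    moreover have "countable {(n::nat, A::nat set). finite A \<and> cylinder n A \<subseteq> X}"
      by (rule countable_subset[OF _ countable_cylinders]) auto
    then have "(\<Union>(n, A) \<in> {(n, A). finite A \<and> cylinder n A \<subseteq> X}. cylinder n A) \<in> sets S"
      using cyl by (intro sets.countable_UN') auto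
    ultimately show ?thesis by simp
  qed
  then have "sigma_sets (space S) {U. openin mtopology U} \<subseteq> sets S"
    by (intro sets.sigma_sets_subset) auto
  then show "sets B \<subseteq> sigma_sets V (range (\<lambda>i. {p \<in> V. l p i}))"
    unfolding S space sets_borel_of topspace_mtopology .
  have "openin mtopology {p \<in> V. l p i}" for i
    unfolding openin_iff_agree
  proof (intro conjI ballI)
    fix p assume "p \<in> {p \<in> V. l p i}"
    then show "\<exists>n. \<forall>q\<in>V. agree n (l p) (l q) \<longrightarrow> q \<in> {p \<in> V. l p i}"
      by (intro exI[of _ "Suc (to_nat i)"]) (auto simp: agree_def)
  qed auto
  then show "sigma_sets V (range (\<lambda>i. {p \<in> V. l p i})) \<subseteq> sets B"
    unfolding sets_borel_of topspace_mtopology by (intro sigma_sets_mono) auto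
qed

lemma label_measurable [measurable]: "Measurable.pred B (\<lambda>p. l p i)"
  unfolding pred_def sets_B space_B by auto

lemma measurable_B_iff:
  "g \<in> measurable N B \<longleftrightarrow> g \<in> space N \<rightarrow> V \<and> (\<forall>i. Measurable.pred N (\<lambda>x. l (g x) i))"
proof
  assume "g \<in> measurable N B"
  then show "g \<in> space N \<rightarrow> V \<and> (\<forall>i. Measurable.pred N (\<lambda>x. l (g x) i))"
    using measurable_space[of g N B] by (auto intro: measurable_compose[OF _ label_measurable])
next
  assume g: "g \<in> space N \<rightarrow> V \<and> (\<forall>i. Measurable.pred N (\<lambda>x. l (g x) i))"
  have "g \<in> measurable N (sigma V (range (\<lambda>i. {p \<in> V. l p i})))"
  proof (rule measurable_measure_of)
    fix X assume "X \<in> range (\<lambda>i. {p \<in> V. l p i})"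
    then obtain i where "X = {p \<in> V. l p i}" by blast
    then have "g -` X \<inter> space N = {x \<in> space N. l (g x) i}" using g by auto
    then show "g -` X \<inter> space N \<in> sets N" using g by (auto simp: pred_def)
  qed (use g in auto)
  moreover have "sets B = sets (sigma V (range (\<lambda>i. {p \<in> V. l p i})))"
    unfolding sets_B by (rule sets_measure_of[symmetric]) auto
  ultimately show "g \<in> measurable N B" using measurable_cong_sets by blast
qed

end

section \<open>The compactification\<close>

text \<open>
  A point is coded by the observables of all nodes reachable from it along words. Among the
  observables, \<open>Code\<close> separates points and generates the Borel sets, \<open>Eq\<close> records the
  isomorphism type of the neighbourhoods, and the colours \<open>Col\<close> keep distinct nodes of a
  neighbourhood distinct in the closure.
\<close>

datatype observable = Code nat | Col nat nat | Eq "nat list" "nat list"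

instance observable :: countable
  by countable_datatype

type_synonym code = "nat list \<times> observable \<Rightarrow> bool"

text \<open>Bit \<open>(w @ u, t)\<close> describes the node reached by \<open>u\<close> from the
  node reached by \<open>w\<close>, so prefixing \<open>w\<close> re-bases a code at the latter
  node.\<close>

definition shift :: "nat list \<Rightarrow> code \<Rightarrow> code" where
  "shift w a = (\<lambda>(u, t). a (w @ u, t))"

lemma shift_apply [simp]: "shift w a (u, t) = a (w @ u, t)"
  by (simp add: shift_def)

lemma shift_Nil [simp]: "shift [] a = a"
  by (auto simp: shift_def)

lemma shift_shift: "shift u (shift w a) = shift (w @ u) a"
  by (auto simp: shift_def)

locale coloured_action = coded_action +
  fixes col :: "nat \<Rightarrow> 'a \<Rightarrow> nat" and K :: "nat \<Rightarrow> nat"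
  assumes col_measurable [measurable]: "\<And>r. col r \<in> measurable M (count_space UNIV)"
    and col_le: "\<And>r x. col r x \<le> K r"
    and col_proper: "\<And>r x w. x \<in> space M \<Longrightarrow> w \<in> words D r \<Longrightarrow> fold f w x \<noteq> x \<Longrightarrow> col r (fold f w x) \<noteq> col r x"
begin

primrec holds :: "observable \<Rightarrow> 'a \<Rightarrow> bool" where
  "holds (Code n) x \<longleftrightarrow> x \<in> U n"
| "holds (Col r k) x \<longleftrightarrow> col r x = k"
| "holds (Eq w v) x \<longleftrightarrow> fold f w x = fold f v x"

definition code_of :: "'a \<Rightarrow> code" where
  "code_of x = (\<lambda>(w, t). holds t (fold f w x))"

lemma code_of_apply [simp]: "code_of x (w, t) \<longleftrightarrow> holds t (fold f w x)"
  by (simp add: code_of_def)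

lemma pred_holds [measurable]: "Measurable.pred M (holds t)"
proof (cases t)
  case (Code n)
  then have "holds t = (\<lambda>x. x \<in> U n)" by auto
  then show ?thesis by simp
next
  case (Col r k)
  then have "holds t = (\<lambda>x. col r x = k)" by auto
  then show ?thesis by simp
next
  case (Eq w v)
  then have "holds t = (\<lambda>x. fold f w x = fold f v x)" by auto
  then show ?thesis using pred_fold_eq by simp
qed

lemma pred_code_of [measurable]: "Measurable.pred M (\<lambda>x. code_of x i)"
proof (cases i)
  case (Pair w t)
  have "Measurable.pred M (\<lambda>x. holds t (fold f w x))" by measurable
  then show ?thesis using Pair by simp
qed

lemma shift_code_of: "shift w (code_of x) = code_of (fold f w x)"
  by (auto simp: shift_def code_of_def)

lemma inj_code_of: "inj_on code_of (space M)"
proof (rule inj_onI, rule ccontr)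
  fix x y assume xy: "x \<in> space M" "y \<in> space M" "code_of x = code_of y" "x \<noteq> y"
  then obtain n where "(x \<in> U n) \<noteq> (y \<in> U n)" using U_separating by blast
  moreover have "code_of x ([], Code n) = code_of y ([], Code n)" using xy(3) by simp
  ultimately show False by simp
qed

section \<open>The closure of the set of codes\<close>

definition codes :: "code set" where
  "codes = {a. \<forall>n. \<exists>x\<in>space M. agree n a (code_of x)}"

text \<open>The transfer principle: facts about limit codes that involve finitely many bits at a
  time are checked on an actual node.\<close>

lemma codes_finite:
  assumes "a \<in> codes" "finite F"
  obtains x where "x \<in> space M" "\<And>i. i \<in> F \<Longrightarrow> a i = code_of x i"
proof -
  obtain n where n: "\<And>a b. agree n a b \<Longrightarrow> \<forall>i\<in>F. a i = (b i :: bool)" using agree_finite_set[OF assms(2)] by blast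
  obtain x where "x \<in> space M" "agree n a (code_of x)" using assms(1) unfolding codes_def by blast
  then show ?thesis using that n by blast
qed

lemma code_of_in_codes: "x \<in> space M \<Longrightarrow> code_of x \<in> codes"
  unfolding codes_def using agree_refl by blast

lemma codes_closed: "(\<And>n. \<exists>b\<in>codes. agree n a b) \<Longrightarrow> a \<in> codes"
  unfolding codes_def using agree_trans by blast

lemma shift_in_codes:
  assumes "a \<in> codes"
  shows "shift w a \<in> codes"
  unfolding codes_def
proof (intro CollectI allI)
  fix n
  define F where "F = (\<lambda>(u, t). (w @ u, t)) ` {i :: nat list \<times> observable. to_nat i < n}"
  have "finite F" unfolding F_def by (intro finite_imageI finite_to_nat_less)
  then obtain x where x: "x \<in> space M" "\<And>i. i \<in> F \<Longrightarrow> a i = code_of x i" using codes_finite[OF assms] by blast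
  have "shift w a (u, t) = code_of (fold f w x) (u, t)" if "to_nat (u, t) < n" for u t
  proof -
    have "(w @ u, t) \<in> F" unfolding F_def using that by force
    then show ?thesis using x(2)[of "(w @ u, t)"] by simp
  qed
  then have "agree n (shift w a) (code_of (fold f w x))" unfolding agree_def by auto
  then show "\<exists>x\<in>space M. agree n (shift w a) (code_of x)" using x(1) by auto
qed

text \<open>If the bit holds, corresponding bits of the two shifts agree, as they do in an
  approximating node. If it fails, the two words reach differently coloured nodes there, and the
  colour bits tell the shifts apart.\<close>

lemma shift_eq_iff:
  assumes a: "a \<in> codes" and w: "set w \<subseteq> {..<D}" and v: "set v \<subseteq> {..<D}"
  shows "shift w a = shift v a \<longleftrightarrow> a ([], Eq w v)"
proof
  assume eq: "a ([], Eq w v)"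
  have "a (w @ u, t) = a (v @ u, t)" for u t
  proof -
    obtain x where x: "\<And>i. i \<in> {([], Eq w v), (w @ u, t), (v @ u, t)} \<Longrightarrow> a i = code_of x i"
      using codes_finite[OF a, of "{([], Eq w v), (w @ u, t), (v @ u, t)}"] by blast
    have "fold f w x = fold f v x" using x[of "([], Eq w v)"] eq by simp
    then show ?thesis using x[of "(w @ u, t)"] x[of "(v @ u, t)"] by simp
  qed
  then show "shift w a = shift v a" unfolding shift_def by simp
next
  assume sh: "shift w a = shift v a"
  show "a ([], Eq w v)"
  proof (rule ccontr)
    assume neq: "\<not> a ([], Eq w v)"
    \<comment> \<open>Going back from the node reached by \<open>w\<close> and then along
      \<open>v\<close> takes at most this many letters, so the colouring \<open>col r\<close>
      separates the two nodes.\<close>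
    define r where "r = length w + length v"
    \<comment> \<open>The colour is known only once \<open>x\<close> is chosen, so all the finitely
      many possible colour bits are fixed beforehand.\<close>
    define F where "F = insert ([], Eq w v) ((\<lambda>k. (w, Col r k)) ` {..K r} \<union> (\<lambda>k. (v, Col r k)) ` {..K r})"
    have "finite F" unfolding F_def by auto
    then obtain x where xM: "x \<in> space M" and x: "\<And>i. i \<in> F \<Longrightarrow> a i = code_of x i"
      using codes_finite[OF a] by blast
    have ne: "fold f v x \<noteq> fold f w x" using x[of "([], Eq w v)"] neq unfolding F_def by auto
    obtain u where u: "set u \<subseteq> {..<D}" "length u \<le> length w" "fold f u (fold f w x) = x"
      using word_reversible[OF xM w] by blast
    have "u @ v \<in> words D r" using u v unfolding words_def r_def by auto
    moreover have "fold f (u @ v) (fold f w x) = fold f v x" using u(3) by simp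
    ultimately have "col r (fold f v x) \<noteq> col r (fold f w x)"
      using col_proper[of "fold f w x" "u @ v" r] ne xM by simp
    moreover define k where "k = col r (fold f w x)"
    have "(w, Col r k) \<in> F" "(v, Col r k) \<in> F" unfolding F_def k_def using col_le by auto
    then have "a (w, Col r k)" "a (v, Col r k) \<longleftrightarrow> col r (fold f v x) = k"
      using x[of "(w, Col r k)"] x[of "(v, Col r k)"] by (simp_all add: k_def)
    moreover have "a (w, Col r k) = a (v, Col r k)" using fun_cong[OF sh, of "([], Col r k)"] by simp
    ultimately show False unfolding k_def by simp
  qed
qed

text \<open>The return letter may vary among approximating nodes; fixing the bits of all
  \<open>D\<close> candidates first makes the one found valid for the limit code as well.\<close>

lemma shift_reversible:
  assumes a: "a \<in> codes" and "i < D" "shift [i] a \<noteq> a"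
  shows "\<exists>j<D. shift [j] (shift [i] a) = a"
proof -
  define F :: "(nat list \<times> observable) set" where "F = insert ([], Eq [i] []) ((\<lambda>j. ([], Eq [i, j] [])) ` {..<D})"
  have "finite F" unfolding F_def by simp
  then obtain x where xM: "x \<in> space M" and x: "\<And>i. i \<in> F \<Longrightarrow> a i = code_of x i"
    using codes_finite[OF a] by blast
  have "\<not> a ([], Eq [i] [])" using shift_eq_iff[OF a, of "[i]" "[]"] assms(2,3) by simp
  then have "f i x \<noteq> x" using x[of "([], Eq [i] [])"] unfolding F_def by simp
  then obtain j where j: "j < D" "f j (f i x) = x" using f_reversible xM assms(2) by blast
  have "([], Eq [i, j] []) \<in> F" unfolding F_def using j(1) by simp
  then have "a ([], Eq [i, j] [])" using x[of "([], Eq [i, j] [])"] j(2) by simp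
  then show ?thesis
    using shift_eq_iff[OF a, of "[i, j]" "[]"] assms(2) j(1) by (auto simp: shift_shift)
qed

end

text \<open>The points are any set in bijection with the limit codes in which the given nodes
  already have their places; this leaves the node type open.\<close>

locale compactification = coloured_action +
  fixes V :: "'v set" and l :: "'v \<Rightarrow> code" and \<iota> :: "'a \<Rightarrow> 'v"
  assumes label_bij: "bij_betw l V codes"
    and emb_V: "\<And>x. x \<in> space M \<Longrightarrow> \<iota> x \<in> V"
    and label_emb: "\<And>x. x \<in> space M \<Longrightarrow> l (\<iota> x) = code_of x"
begin

lemma label_codes: "p \<in> V \<Longrightarrow> l p \<in> codes"
  using label_bij by (rule bij_betw_apply)

lemma label_eq_iff: "p \<in> V \<Longrightarrow> q \<in> V \<Longrightarrow> l p = l q \<longleftrightarrow> p = q"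
  using label_bij unfolding bij_betw_def by (auto dest: inj_onD)

sublocale labelled_cantor V l
proof
  show "inj_on l V" using label_bij by (rule bij_betw_imp_inj_on)
  fix a assume "\<And>n. \<exists>p\<in>V. agree n a (l p)"
  then have "a \<in> codes" using label_codes by (intro codes_closed) blast
  then show "\<exists>p\<in>V. l p = a" using label_bij unfolding bij_betw_def by (metis imageE)
qed

definition move :: "nat list \<Rightarrow> 'v \<Rightarrow> 'v" where
  "move w p = inv_into V l (shift w (l p))"

lemma
  assumes "p \<in> V"
  shows move_V [simp]: "move w p \<in> V" and label_move [simp]: "l (move w p) = shift w (l p)"
proof -
  have "shift w (l p) \<in> l ` V"
    using shift_in_codes[OF label_codes[OF assms]] label_bij by (simp add: bij_betw_def)
  then show "move w p \<in> V" "l (move w p) = shift w (l p)"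
    unfolding move_def by (auto intro: inv_into_into f_inv_into_f)
qed

lemma move_eq_iff: "p \<in> V \<Longrightarrow> q \<in> V \<Longrightarrow> q = move w p \<longleftrightarrow> l q = shift w (l p)"
  using label_eq_iff[of q "move w p"] by simp

lemma move_Nil [simp]: "p \<in> V \<Longrightarrow> move [] p = p"
  using move_eq_iff[of p p "[]"] by simp

lemma move_append: "p \<in> V \<Longrightarrow> move (w @ u) p = move u (move w p)"
  using move_eq_iff[of "move w p" "move (w @ u) p" u] by (simp add: shift_shift)

lemma move_emb: "x \<in> space M \<Longrightarrow> move w (\<iota> x) = \<iota> (fold f w x)"
  using move_eq_iff[of "\<iota> x" "\<iota> (fold f w x)" w] by (simp add: emb_V label_emb shift_code_of)

lemma move_eq_move_iff:
  assumes "p \<in> V" "set w \<subseteq> {..<D}" "set v \<subseteq> {..<D}"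
  shows "move w p = move v p \<longleftrightarrow> l p ([], Eq w v)"
  using label_eq_iff[of "move w p" "move v p"] shift_eq_iff[OF label_codes] assms by simp

lemma emb_eq_iff: "x \<in> space M \<Longrightarrow> y \<in> space M \<Longrightarrow> \<iota> x = \<iota> y \<longleftrightarrow> x = y"
  using inj_onD[OF inj_code_of, of x y] label_emb by metis

lemma move_measurable [measurable]: "move w \<in> measurable B B"
  unfolding measurable_B_iff
proof (intro conjI allI)
  fix i :: "nat list \<times> observable"
  obtain u t where i: "i = (u, t)" by fastforce
  have "Measurable.pred B (\<lambda>p. l p (w @ u, t))" by measurable
  then show "Measurable.pred B (\<lambda>p. l (move w p) i)"
    by (subst measurable_cong[where g = "\<lambda>p. l p (w @ u, t)"]) (auto simp: i)
qed simp

lemma emb_measurable [measurable]: "\<iota> \<in> measurable M B"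
  unfolding measurable_B_iff
proof (intro conjI allI)
  fix i :: "nat list \<times> observable"
  show "Measurable.pred M (\<lambda>x. l (\<iota> x) i)"
    by (subst measurable_cong[where g = "\<lambda>x. code_of x i"]) (auto simp: label_emb)
qed (simp add: emb_V)

section \<open>The edge relation and its neighbourhoods\<close>

definition edges :: "('v \<times> 'v) set" where
  "edges = {(p, q). p \<in> V \<and> p \<noteq> q \<and> (\<exists>i<D. q = move [i] p)}"

lemma edges_V: "(p, q) \<in> edges \<Longrightarrow> p \<in> V \<and> q \<in> V"
  unfolding edges_def by auto

text \<open>Replaces the open condition that the endpoints differ by one bit of a label, which is
  what makes the relation closed and measurable.\<close>

lemma edges_iff_label:
  "(p, q) \<in> edges \<longleftrightarrow> p \<in> V \<and> q \<in> V \<and> (\<exists>i<D. \<not> l p ([], Eq [i] []) \<and> l q = shift [i] (l p))"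
proof -
  have "p \<noteq> move [i] p \<longleftrightarrow> \<not> l p ([], Eq [i] [])" if "p \<in> V" "i < D" for i
    using move_eq_move_iff[of p "[i]" "[]"] that by auto
  then show ?thesis unfolding edges_def using move_eq_iff[of p q] by fastforce
qed

lemma sym_edges: "sym edges"
proof (rule symI)
  fix p q assume pq: "(p, q) \<in> edges"
  then obtain i where i: "p \<in> V" "p \<noteq> q" "i < D" "q = move [i] p" unfolding edges_def by blast
  then have "shift [i] (l p) \<noteq> l p" using label_eq_iff[of q p] by simp
  then obtain j where "j < D" "shift [j] (shift [i] (l p)) = l p"
    using shift_reversible[OF label_codes[OF i(1)] i(3)] by blast
  then have "p = move [j] q" using move_eq_iff[of q p "[j]"] i by simp
  then show "(q, p) \<in> edges" unfolding edges_def using \<open>j < D\<close> i by auto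
qed

lemma irrefl_edges: "irrefl edges"
  unfolding edges_def irrefl_def by auto

lemma neighbours_subset: "{q \<in> X. (p, q) \<in> edges} \<subseteq> (\<lambda>i. move [i] p) ` {..<D}"
  unfolding edges_def by auto

lemma finite_neighbours: "finite {q \<in> X. (p, q) \<in> edges}"
  by (rule finite_subset[OF neighbours_subset]) simp

lemma deg_edges_le: "deg edges X p \<le> D"
  unfolding deg_def using card_mono[OF _ neighbours_subset, of p X] card_image_le[of "{..<D}" "\<lambda>i. move [i] p"]
  by simp

lemma edges_measurable: "edges \<in> sets (B \<Otimes>\<^sub>M B)"
proof -
  have [measurable]: "Measurable.pred (B \<Otimes>\<^sub>M B) (\<lambda>z. l (fst z) i)" "Measurable.pred (B \<Otimes>\<^sub>M B) (\<lambda>z. l (snd z) i)" for i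
    by (rule measurable_compose[OF measurable_fst label_measurable])
       (rule measurable_compose[OF measurable_snd label_measurable])
  have "edges = {z \<in> space (B \<Otimes>\<^sub>M B). \<exists>i<D. \<not> l (fst z) ([], Eq [i] []) \<and> (\<forall>u t. l (snd z) (u, t) = l (fst z) ([i] @ u, t))}"
    by (auto simp: edges_iff_label space_pair_measure shift_def fun_eq_iff)
  also have "\<dots> \<in> sets (B \<Otimes>\<^sub>M B)" by measurable
  finally show ?thesis .
qed

lemma openin_agree: "openin mtopology {q \<in> V. agree n a (l q)}"
  unfolding openin_iff_agree using agree_trans by blast

text \<open>Each letter fails to be an edge from \<open>p\<close> to \<open>q\<close> for a reason
  visible in finitely many bits: it fixes \<open>p\<close>, or some bit of \<open>l q\<close>
  differs from the shifted label. With only \<open>D\<close> letters, finitely many bits exclude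
  nearby pairs as well.\<close>

lemma closedin_edges: "closedin (prod_topology mtopology mtopology) edges"
  unfolding closedin_def topspace_prod_topology topspace_mtopology openin_prod_topology_alt
proof (intro conjI allI impI)
  show "edges \<subseteq> V \<times> V" using edges_V by auto
  fix p q assume "(p, q) \<in> V \<times> V - edges"
  then have pq: "p \<in> V" "q \<in> V" "(p, q) \<notin> edges" by auto
  then have "\<forall>i. \<exists>u t. i < D \<longrightarrow> \<not> l p ([], Eq [i] []) \<longrightarrow> l q (u, t) \<noteq> l p ([i] @ u, t)"
    unfolding edges_iff_label shift_def by (fastforce simp: fun_eq_iff)
  then obtain u t where ut: "\<And>i. i < D \<Longrightarrow> \<not> l p ([], Eq [i] []) \<Longrightarrow> l q (u i, t i) \<noteq> l p ([i] @ u i, t i)"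
    by metis
  define F where "F = (\<Union>i<D. {([], Eq [i] []), (u i, t i), ([i] @ u i, t i)})"
  have "finite F" unfolding F_def by simp
  then obtain n where n: "\<And>a b. agree n a b \<Longrightarrow> \<forall>i\<in>F. a i = (b i :: bool)"
    using agree_finite_set by blast
  have "(p', q') \<notin> edges" if "agree n (l p) (l p')" "agree n (l q) (l q')" for p' q'
  proof
    assume "(p', q') \<in> edges"
    then obtain i where i: "i < D" "\<not> l p' ([], Eq [i] [])" "l q' = shift [i] (l p')"
      unfolding edges_iff_label by blast
    have F: "{([], Eq [i] []), (u i, t i), ([i] @ u i, t i)} \<subseteq> F" unfolding F_def using i(1) by blast
    have "l p ([], Eq [i] []) = l p' ([], Eq [i] [])" "l p ([i] @ u i, t i) = l p' ([i] @ u i, t i)"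
      "l q (u i, t i) = l q' (u i, t i)"
      using n[OF that(1)] n[OF that(2)] F by blast+
    then show False using ut[OF i(1)] i(2,3) by simp
  qed
  then have "{p' \<in> V. agree n (l p) (l p')} \<times> {q' \<in> V. agree n (l q) (l q')} \<subseteq> V \<times> V - edges" by auto
  then show "\<exists>X Y. openin mtopology X \<and> openin mtopology Y \<and> p \<in> X \<and> q \<in> Y \<and> X \<times> Y \<subseteq> V \<times> V - edges"
    using pq openin_agree[of n "l p"] openin_agree[of n "l q"]
    by (intro exI[of _ "{p' \<in> V. agree n (l p) (l p')}"] exI[of _ "{q' \<in> V. agree n (l q) (l q')}"]) auto
qed

text \<open>Balls become images of one finite set of words, the same for all centres. Letters that
  fix the current point cost no edge, so a word may be longer than its path.\<close>

lemma gball_edges: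
  assumes p: "p \<in> V"
  shows "gball V edges p r = (\<lambda>w. move w p) ` words D r"
proof (intro equalityI subsetI)
  have "\<exists>w\<in>words D n. q = move w p" if "(p, q) \<in> edges ^^ n" for n q
    using that
  proof (induction n arbitrary: q)
    case 0
    then show ?case using p by (intro bexI[of _ "[]"]) (auto simp: words_def)
  next
    case (Suc n)
    then obtain z where z: "(p, z) \<in> edges ^^ n" "(z, q) \<in> edges" by auto
    then obtain w where w: "w \<in> words D n" "z = move w p" using Suc.IH by blast
    obtain i where "i < D" "q = move [i] z" using z(2) unfolding edges_def by blast
    then have "w @ [i] \<in> words D (Suc n)" "q = move (w @ [i]) p"
      using w p by (auto simp: words_def move_append)
    then show ?case by blast
  qed
  then show "q \<in> (\<lambda>w. move w p) ` words D r" if "q \<in> gball V edges p r" for q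
    using that words_mono[of _ r D] unfolding gball_def by blast
next
  have path: "\<exists>n\<le>length w. (p, move w p) \<in> edges ^^ n" if "set w \<subseteq> {..<D}" for w
    using that
  proof (induction w rule: rev_induct)
    case Nil
    then show ?case using p by simp
  next
    case (snoc i w)
    then obtain n where n: "n \<le> length w" "(p, move w p) \<in> edges ^^ n" by auto
    have m: "move (w @ [i]) p = move [i] (move w p)" by (rule move_append[OF p])
    show ?case
    proof (cases "move [i] (move w p) = move w p")
      case True
      then show ?thesis using n m by (intro exI[of _ n]) auto
    next
      case False
      then have "(move w p, move (w @ [i]) p) \<in> edges"
        unfolding edges_def m using p snoc.prems by auto
      then show ?thesis using n by (intro exI[of _ "Suc n"]) auto
    qed
  qed
  show "q \<in> gball V edges p r" if q: "q \<in> (\<lambda>w. move w p) ` words D r" for q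
  proof -
    obtain w where w: "w \<in> words D r" "q = move w p" using q by blast
    then obtain n where "n \<le> length w" "(p, q) \<in> edges ^^ n" using path[of w] unfolding words_def by auto
    moreover have "length w \<le> r" "q \<in> V" using w p by (simp_all add: words_def)
    ultimately show ?thesis unfolding gball_def by (blast intro: le_trans)
  qed
qed

lemma compact_neighbourhoods:
  assumes "\<epsilon> > 0"
  shows "\<exists>\<delta>>0. \<forall>x\<in>V. \<forall>y\<in>V. ldist x y < \<delta> \<longrightarrow>
    (\<exists>r \<phi>. real r \<ge> 1 / \<epsilon> - 1 \<and> neighborhood_iso V edges r x y \<phi> \<and>
       (\<forall>z\<in>gball V edges x r. ldist z (\<phi> z) \<le> \<epsilon>))"
proof -
  define r where "r = nat \<lceil>1 / \<epsilon>\<rceil>"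
  have r: "1 / \<epsilon> \<le> real r" unfolding r_def by linarith
  obtain m where m: "inverse (real (Suc m)) < \<epsilon>" using reals_Archimedean[OF assms] by auto
  \<comment> \<open>Words up to length \<open>Suc r\<close> occur because an edge inside the ball is
    an equation \<open>move v x = move (w @ [i]) x\<close>. The second group controls the first
    \<open>m\<close> bits after every move, which bounds the displacement by
    \<open>\<epsilon>\<close>.\<close>
  define F :: "(nat list \<times> observable) set" where "F = (\<lambda>(w, v). ([], Eq w v)) ` (words D (Suc r) \<times> words D (Suc r)) \<union>
     (\<lambda>(w, u, t). (w @ u, t)) ` (words D r \<times> {i :: nat list \<times> observable. to_nat i < m})"
  have "finite F" unfolding F_def
    by (intro finite_UnI finite_imageI finite_cartesian_product finite_words finite_to_nat_less)
  then obtain n where n: "\<And>a b. agree n a b \<Longrightarrow> \<forall>i\<in>F. a i = (b i :: bool)"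
    using agree_finite_set by blast
  have "\<exists>\<phi>. neighborhood_iso V edges r x y \<phi> \<and> (\<forall>z\<in>gball V edges x r. ldist z (\<phi> z) \<le> \<epsilon>)"
    if xy: "x \<in> V" "y \<in> V" "ldist x y < inverse (real (Suc n))" for x y
  proof -
    have F: "\<forall>i\<in>F. l x i = l y i" using n ldist_less[OF xy(3)] by blast
    have same: "move w x = move v x \<longleftrightarrow> move w y = move v y" if "w \<in> words D (Suc r)" "v \<in> words D (Suc r)" for w v
    proof -
      have "([], Eq w v) \<in> F" unfolding F_def using that by force
      then have "l x ([], Eq w v) = l y ([], Eq w v)" using F by blast
      then show ?thesis
        using move_eq_move_iff[OF xy(1), of w v] move_eq_move_iff[OF xy(2), of w v] that
        unfolding words_def by auto
    qed
    have mono: "w \<in> words D (Suc r)" if "w \<in> words D r" for w using that words_mono[of r "Suc r" D] by auto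
    have close: "ldist (move w x) (move w y) \<le> \<epsilon>" if w: "w \<in> words D r" for w
    proof -
      have "shift w (l x) (u, t) = shift w (l y) (u, t)" if "to_nat (u, t) < m" for u t
      proof -
        have "(w @ u, t) \<in> F" unfolding F_def using w that by force
        then show ?thesis using F by simp
      qed
      then have "agree m (l (move w x)) (l (move w y))" unfolding agree_def using xy by auto
      then have "ldist (move w x) (move w y) \<le> inverse (real (Suc m))" by (simp only: ldist_le_iff)
      then show ?thesis using m by linarith
    qed
    \<comment> \<open>The choice of the word is immaterial by \<open>same\<close>: words that agree
      at \<open>x\<close> agree at \<open>y\<close>.\<close>
    define \<phi> where "\<phi> = (\<lambda>z. move (SOME w. w \<in> words D r \<and> move w x = z) y)"
    have \<phi>: "\<phi> (move w x) = move w y" if "w \<in> words D r" for w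
    proof -
      define v where "v = (SOME v. v \<in> words D r \<and> move v x = move w x)"
      have "v \<in> words D r \<and> move v x = move w x"
        unfolding v_def by (rule someI[of _ w]) (use that in simp)
      then have "move v y = move w y" using same[of v w] mono that by blast
      then show ?thesis unfolding \<phi>_def v_def .
    qed
    have "bij_betw \<phi> (gball V edges x r) (gball V edges y r)"
      unfolding bij_betw_def gball_edges[OF xy(1)] gball_edges[OF xy(2)]
    proof
      show "inj_on \<phi> ((\<lambda>w. move w x) ` words D r)" by (rule inj_onI) (auto simp: \<phi> same mono)
      show "\<phi> ` (\<lambda>w. move w x) ` words D r = (\<lambda>w. move w y) ` words D r"
        unfolding image_image by (rule image_cong) (auto simp: \<phi>)
    qed
    moreover have "(\<forall>z\<in>gball V edges x r. \<forall>z'\<in>gball V edges x r. (z, z') \<in> edges \<longleftrightarrow> (\<phi> z, \<phi> z') \<in> edges)"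
    proof (intro ballI)
      fix z z' assume "z \<in> gball V edges x r" "z' \<in> gball V edges x r"
      then obtain w v where wv: "w \<in> words D r" "z = move w x" "v \<in> words D r" "z' = move v x"
        unfolding gball_edges[OF xy(1)] by blast
      have "w @ [i] \<in> words D (Suc r)" if "i < D" for i using wv(1) that unfolding words_def by auto
      then have "(move v x = move (w @ [i]) x) = (move v y = move (w @ [i]) y)" if "i < D" for i
        using same[of v "w @ [i]"] mono wv(3) that by blast
      moreover have "(move w x = move v x) = (move w y = move v y)" using same mono wv by blast
      ultimately have "(move w x, move v x) \<in> edges \<longleftrightarrow> (move w y, move v y) \<in> edges"
        unfolding edges_def using xy by (auto simp: move_append)
      then show "(z, z') \<in> edges \<longleftrightarrow> (\<phi> z, \<phi> z') \<in> edges" using wv \<phi> by simp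
    qed
    moreover have "\<phi> x = y" using \<phi>[of "[]"] xy by (simp add: words_def)
    ultimately have "neighborhood_iso V edges r x y \<phi>" unfolding neighborhood_iso_def by blast
    moreover have "\<forall>z\<in>gball V edges x r. ldist z (\<phi> z) \<le> \<epsilon>"
      unfolding gball_edges[OF xy(1)] using close \<phi> by simp
    ultimately show ?thesis by blast
  qed
  moreover have "real r \<ge> 1 / \<epsilon> - 1" using r by linarith
  moreover have "inverse (real (Suc n)) > 0" by simp
  ultimately show ?thesis by blast
qed

lemma deg_measurable:
  assumes X [measurable]: "X \<in> sets B"
  shows "(\<lambda>p. of_nat (deg edges X p) :: ennreal) \<in> borel_measurable B"
proof -
  \<comment> \<open>Several letters may lead to the same neighbour; only the first of them is
    counted, and coincidences are read off the label.\<close>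
  define P where "P = (\<lambda>i p. move [i] p \<in> X \<and> \<not> l p ([], Eq [i] []) \<and> (\<forall>j<i. \<not> l p ([], Eq [j] [i])))"
  have "deg edges X p = (\<Sum>i<D. of_bool (P i p))" if p: "p \<in> V" for p
  proof -
    have P: "P i p \<longleftrightarrow> move [i] p \<in> X \<and> move [i] p \<noteq> p \<and> (\<forall>j<i. move [j] p \<noteq> move [i] p)" if "i < D" for i
      unfolding P_def using move_eq_move_iff[OF p, of "[i]" "[]"] move_eq_move_iff[OF p, of _ "[i]"] p that by fastforce
    have "{q \<in> X. (p, q) \<in> edges} = (\<lambda>i. move [i] p) ` {i\<in>{..<D}. P i p}"
    proof (intro equalityI subsetI)
      fix q assume "q \<in> {q \<in> X. (p, q) \<in> edges}"
      then have q: "q \<in> X" "q \<noteq> p" "\<exists>i. i < D \<and> q = move [i] p" unfolding edges_def by auto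
      define i where "i = (LEAST i. i < D \<and> q = move [i] p)"
      have i: "i < D" "q = move [i] p" using LeastI_ex[OF q(3)] unfolding i_def by auto
      have "move [j] p \<noteq> q" if "j < i" for j
        using not_less_Least[of j "\<lambda>i. i < D \<and> q = move [i] p"] that i(1) unfolding i_def by auto
      then have "P i p" using P[OF i(1)] q i by auto
      then show "q \<in> (\<lambda>i. move [i] p) ` {i\<in>{..<D}. P i p}" using i by blast
    next
      fix q assume "q \<in> (\<lambda>i. move [i] p) ` {i\<in>{..<D}. P i p}"
      then show "q \<in> {q \<in> X. (p, q) \<in> edges}" using P p unfolding edges_def by fastforce
    qed
    moreover have "inj_on (\<lambda>i. move [i] p) {i\<in>{..<D}. P i p}"
    proof (rule linorder_inj_onI')
      fix i j assume "i \<in> {i\<in>{..<D}. P i p}" "j \<in> {i\<in>{..<D}. P i p}" "i < j"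
      then show "move [i] p \<noteq> move [j] p" using P[of j] by auto
    qed
    ultimately have "deg edges X p = card {i\<in>{..<D}. P i p}" unfolding deg_def by (simp add: card_image)
    then show ?thesis by (simp add: of_bool_def sum.If_cases Int_def)
  qed
  then have eq: "of_nat (deg edges X p) = (\<Sum>i<D. if P i p then 1 else 0 :: ennreal)" if "p \<in> space B" for p
    using that by (simp add: of_bool_def if_distrib[of of_nat] cong: if_cong)
  have "Measurable.pred B (P i)" for i unfolding P_def by measurable
  then have "(\<lambda>p. \<Sum>i<D. if P i p then 1 else 0 :: ennreal) \<in> borel_measurable B" by measurable
  then show ?thesis by (simp only: measurable_cong[OF eq])
qed

end

section \<open>The push-forward measure and the embedded copy\<close>

context compactification
begin

abbreviation "M' \<equiv> distr M B \<iota>"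

lemma deg_edges_emb:
  assumes E: "\<And>x y. (x, y) \<in> E \<longleftrightarrow> x \<in> space M \<and> y \<noteq> x \<and> (\<exists>i<D. y = f i x)" and x: "x \<in> space M"
  shows "deg edges Y (\<iota> x) = deg E (\<iota> -` Y \<inter> space M) x"
proof -
  have "{q \<in> Y. (\<iota> x, q) \<in> edges} = \<iota> ` {y \<in> \<iota> -` Y \<inter> space M. (x, y) \<in> E}"
  proof (intro equalityI subsetI)
    fix q assume "q \<in> {q \<in> Y. (\<iota> x, q) \<in> edges}"
    then obtain i where i: "q \<in> Y" "\<iota> x \<noteq> q" "i < D" "q = move [i] (\<iota> x)" unfolding edges_def by auto
    then have "q = \<iota> (f i x)" using move_emb[OF x, of "[i]"] by simp
    moreover have "f i x \<in> space M" using x by (rule measurable_space[OF f_measurable])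
    ultimately show "q \<in> \<iota> ` {y \<in> \<iota> -` Y \<inter> space M. (x, y) \<in> E}" using i x unfolding E by auto
  next
    fix q assume "q \<in> \<iota> ` {y \<in> \<iota> -` Y \<inter> space M. (x, y) \<in> E}"
    then obtain i where i: "q = \<iota> (f i x)" "q \<in> Y" "f i x \<in> space M" "f i x \<noteq> x" "i < D" unfolding E by auto
    then have "\<iota> x \<noteq> q" using emb_eq_iff[OF x] by auto
    moreover have "q = move [i] (\<iota> x)" using i(1) move_emb[OF x, of "[i]"] by simp
    ultimately show "q \<in> {q \<in> Y. (\<iota> x, q) \<in> edges}" using i emb_V[OF x] unfolding edges_def by auto
  qed
  moreover have "inj_on \<iota> {y \<in> \<iota> -` Y \<inter> space M. (x, y) \<in> E}" by (rule inj_onI) (auto simp: emb_eq_iff)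
  ultimately show ?thesis unfolding deg_def by (simp add: card_image)
qed

text \<open>Measure preservation is inherited by change of variables along \<open>\<iota>\<close>.
  The degree bound extends to the new nodes, as every neighbour is reached by one of
  \<open>D\<close> letters.\<close>

lemma compact_graphing_closure:
  assumes "graphing D M E"
    and E: "\<And>x y. (x, y) \<in> E \<longleftrightarrow> x \<in> space M \<and> y \<noteq> x \<and> (\<exists>i<D. y = f i x)"
  shows "compact_graphing D M' edges"
proof -
  have "graphing D M' edges"
    unfolding graphing_def
  proof (intro conjI ballI)
    have "prob_space M" using assms(1) unfolding graphing_def standard_prob_space_def by blast
    then have "prob_space M'" by (rule prob_space.prob_space_distr) simp
    moreover have "standard_borel M'" using standard_borel_B unfolding standard_borel_def by simp
    ultimately show "standard_prob_space M'" unfolding standard_prob_space_def by blast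
    have "sets (M' \<Otimes>\<^sub>M M') = sets (B \<Otimes>\<^sub>M B)" by (rule sets_pair_measure_cong) simp_all
    then show "edges \<in> sets (M' \<Otimes>\<^sub>M M')" using edges_measurable by simp
    show "sym edges" "irrefl edges" by (rule sym_edges irrefl_edges)+
    show "finite {q \<in> space M'. (p, q) \<in> edges}" "deg edges (space M') p \<le> D" for p
      by (rule finite_neighbours deg_edges_le)+
    fix X Y assume "X \<in> sets M'" "Y \<in> sets M'"
    then have XY [measurable]: "X \<in> sets B" "Y \<in> sets B" by simp_all
    have int: "(\<integral>\<^sup>+p\<in>X. of_nat (deg edges Y p) \<partial>M') =
        (\<integral>\<^sup>+x\<in>\<iota> -` X \<inter> space M. of_nat (deg E (\<iota> -` Y \<inter> space M) x) \<partial>M)"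
      if [measurable]: "X \<in> sets B" and Y: "Y \<in> sets B" for X Y
    proof -
      note deg_measurable[OF Y, measurable]
      have "(\<integral>\<^sup>+p\<in>X. of_nat (deg edges Y p) \<partial>M') = (\<integral>\<^sup>+x. of_nat (deg edges Y (\<iota> x)) * indicator X (\<iota> x) \<partial>M)"
        by (rule nn_integral_distr) measurable
      also have "\<dots> = (\<integral>\<^sup>+x\<in>\<iota> -` X \<inter> space M. of_nat (deg E (\<iota> -` Y \<inter> space M) x) \<partial>M)"
        by (rule nn_integral_cong) (simp add: deg_edges_emb[OF E] indicator_def)
      finally show ?thesis .
    qed
    have "\<iota> -` X \<inter> space M \<in> sets M" "\<iota> -` Y \<inter> space M \<in> sets M" by measurable
    then show "(\<integral>\<^sup>+p\<in>X. of_nat (deg edges Y p) \<partial>M') = (\<integral>\<^sup>+p\<in>Y. of_nat (deg edges X p) \<partial>M')"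
      using assms(1) unfolding int[OF XY] int[OF XY(2,1)] graphing_def by blast
  qed
  then show ?thesis
    unfolding compact_graphing_def
    using Metric_space_axioms compact_space_labels closedin_edges compact_neighbourhoods
    by (intro conjI exI[of _ ldist]) simp_all
qed

text \<open>Edges at an embedded node lead to embedded nodes, so the copy is a union of components.
  Its Borel sets are traces because each generator \<open>U n\<close> is the trace of the bit
  \<open>([], Code n)\<close>, and traces form a sigma-algebra.\<close>

lemma strong_subgraphing_closure:
  assumes inj: "inj \<iota>"
    and E: "\<And>x y. (x, y) \<in> E \<longleftrightarrow> x \<in> space M \<and> y \<noteq> x \<and> (\<exists>i<D. y = f i x)"
  shows "strong_subgraphing (embed_measure M \<iota>) (map_prod \<iota> \<iota> ` E) M' edges"
proof -
  have inj': "inj_on \<iota> (space M)" using inj by (rule inj_on_subset) simp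
  have edge_iff: "(\<iota> x, q) \<in> edges \<longleftrightarrow> (\<exists>y. q = \<iota> y \<and> (x, y) \<in> E)" if x: "x \<in> space M" for x q
  proof
    assume "(\<iota> x, q) \<in> edges"
    then obtain i where "\<iota> x \<noteq> q" "i < D" "q = \<iota> (f i x)"
      unfolding edges_def using move_emb[OF x, of "[i]" for i] by auto
    then show "\<exists>y. q = \<iota> y \<and> (x, y) \<in> E" using x E by auto
  next
    assume "\<exists>y. q = \<iota> y \<and> (x, y) \<in> E"
    then obtain i where i: "q = \<iota> (f i x)" "f i x \<noteq> x" "i < D" unfolding E by auto
    then have "\<iota> x \<noteq> q" using inj_eq[OF inj, of x "f i x"] by auto
    then show "(\<iota> x, q) \<in> edges" unfolding edges_def using i emb_V[OF x] move_emb[OF x, of "[i]"] by auto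
  qed
  have E_space: "x \<in> space M" "y \<in> space M" if "(x, y) \<in> E" for x y
    using that measurable_space[OF f_measurable] unfolding E by auto
  have reach: "q \<in> \<iota> ` space M" if "(\<iota> x, q) \<in> edges\<^sup>*" "x \<in> space M" for x q
    using that
  proof (induction rule: rtrancl_induct)
    case (step y z)
    then obtain x' where "x' \<in> space M" "y = \<iota> x'" by blast
    then obtain y' where "z = \<iota> y'" "(x', y') \<in> E" using edge_iff step.hyps(2) by blast
    then show ?case using E_space(2) by blast
  qed simp
  define \<C> where "\<C> = (\<lambda>x. {q \<in> V. (\<iota> x, q) \<in> edges\<^sup>*}) ` space M"
  have "\<C> \<subseteq> connected_comps V edges" unfolding \<C>_def connected_comps_def using emb_V by auto
  moreover have "\<iota> ` space M = \<Union>\<C>" unfolding \<C>_def using reach emb_V by auto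
  moreover have "map_prod \<iota> \<iota> ` E = edges \<inter> (\<iota> ` space M \<times> \<iota> ` space M)"
  proof (intro equalityI subsetI)
    fix z assume "z \<in> map_prod \<iota> \<iota> ` E"
    then obtain x y where "(x, y) \<in> E" "z = (\<iota> x, \<iota> y)" by auto
    then show "z \<in> edges \<inter> (\<iota> ` space M \<times> \<iota> ` space M)" using edge_iff E_space[of x y] by auto
  next
    fix z assume "z \<in> edges \<inter> (\<iota> ` space M \<times> \<iota> ` space M)"
    then obtain x q where "x \<in> space M" "z = (\<iota> x, q)" "(\<iota> x, q) \<in> edges" by auto
    then show "z \<in> map_prod \<iota> \<iota> ` E" using edge_iff by force
  qed
  moreover have "{\<iota> ` A |A. A \<in> sets M} = (\<lambda>X. \<iota> ` space M \<inter> X) ` sets B"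
  proof (intro equalityI subsetI)
    fix Z assume "Z \<in> {\<iota> ` A |A. A \<in> sets M}"
    then obtain A where A: "A \<in> sets M" "Z = \<iota> ` A" by blast
    have "\<exists>X\<in>sets B. \<iota> ` A = \<iota> ` space M \<inter> X" using A(1) unfolding sets_U
    proof induction
      case (Basic A)
      then obtain n where n: "A = U n" by blast
      have "{p \<in> space B. l p ([], Code n)} \<in> sets B" by measurable
      moreover have "\<iota> ` A = \<iota> ` space M \<inter> {p \<in> space B. l p ([], Code n)}"
        using sets.sets_into_space[OF U_sets[of n]] unfolding n by (auto simp: emb_V label_emb)
      ultimately show ?case by blast
    next
      case Empty
      then show ?case by (intro bexI[of _ "{}"]) auto
    next
      case (Compl A)
      then obtain X where X: "X \<in> sets B" "\<iota> ` A = \<iota> ` space M \<inter> X" by blast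
      have "\<iota> ` (space M - A) = \<iota> ` space M - \<iota> ` A" using inj by (rule image_set_diff)
      then have "\<iota> ` (space M - A) = \<iota> ` space M \<inter> (space B - X)"
        unfolding X(2) using emb_V by auto
      then show ?case using X(1) by blast
    next
      case (Union A)
      then have "\<forall>n. \<exists>X. X \<in> sets B \<and> \<iota> ` A n = \<iota> ` space M \<inter> X" by blast
      then obtain X where X: "\<And>n. X n \<in> sets B" "\<And>n. \<iota> ` A n = \<iota> ` space M \<inter> X n" by metis
      then have "\<iota> ` (\<Union>n. A n) = \<iota> ` space M \<inter> (\<Union>n. X n)" by (simp add: image_UN)
      moreover have "(\<Union>n. X n) \<in> sets B" using X(1) by (intro sets.countable_UN) auto
      ultimately show ?case by (intro bexI[of _ "\<Union>n. X n"])
    qed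
    then show "Z \<in> (\<lambda>X. \<iota> ` space M \<inter> X) ` sets B" using A(2) by blast
  next
    fix Z assume "Z \<in> (\<lambda>X. \<iota> ` space M \<inter> X) ` sets B"
    then obtain X where [measurable]: "X \<in> sets B" and Z: "Z = \<iota> ` space M \<inter> X" by blast
    have "\<iota> -` X \<inter> space M \<in> sets M" by measurable
    moreover have "Z = \<iota> ` (\<iota> -` X \<inter> space M)" unfolding Z by auto
    ultimately show "Z \<in> {\<iota> ` A |A. A \<in> sets M}" by blast
  qed
  moreover have "emeasure M' X = emeasure (embed_measure M \<iota>) (\<iota> ` space M \<inter> X)" if "X \<in> sets B" for X
  proof -
    have "\<iota> ` space M \<inter> X = \<iota> ` (\<iota> -` X \<inter> space M)" by auto
    moreover have "\<iota> -` X \<inter> space M \<in> sets M" using emb_measurable that by (rule measurable_sets)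
    ultimately show ?thesis
      using that emeasure_embed_measure_image[OF inj, of "\<iota> -` X \<inter> space M" M] by (simp add: emeasure_distr)
  qed
  moreover have "\<iota> ` space M \<subseteq> V" using emb_V by auto
  ultimately show ?thesis
    unfolding strong_subgraphing_def sets_embed_measure'[OF inj'] space_embed_measure
      sets_distr space_distr space_borel_of topspace_mtopology
    by (intro conjI exI[of _ \<C>] ballI)
qed

end

lemma standard_borel_generating_sequence:
  fixes M :: "'a measure"
  assumes "standard_borel M"
  obtains U :: "nat \<Rightarrow> 'a set" where "sets M = sigma_sets (space M) (range U)"
    "\<And>x y. x \<in> space M \<Longrightarrow> y \<in> space M \<Longrightarrow> x \<noteq> y \<Longrightarrow> \<exists>n. (x \<in> U n) \<noteq> (y \<in> U n)"
proof (cases "space M = {}")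
  case True
  then have "sets M = range (\<lambda>n::nat. {})" by (simp add: space_empty_iff)
  then have "sets M = sigma_sets (space M) (range (\<lambda>n::nat. {}))" using sets.sigma_sets_eq[of M] by simp
  then show ?thesis by (rule that) (simp add: True)
next
  case False
  then obtain \<rho> :: "'a \<Rightarrow> real" where inj: "inj_on \<rho> (space M)"
    and \<rho>: "\<And>A. A \<subseteq> space M \<Longrightarrow> A \<in> sets M \<longleftrightarrow> \<rho> ` A \<in> sets borel"
    using standard_borel_real_coding[OF assms] by blast
  obtain A :: "real set set" where A: "countable A" "topological_basis A" using ex_countable_basis by blast
  then have "A \<noteq> {}" using topological_basisE[of A UNIV] by blast
  define U where "U = (\<lambda>n. \<rho> -` from_nat_into A n \<inter> space M)"
  have "sets M = sets (vimage_algebra (space M) \<rho> borel)"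
  proof (intro equalityI subsetI)
    fix S assume S: "S \<in> sets M"
    then have "S \<subseteq> space M" by (rule sets.sets_into_space)
    then have "S = \<rho> -` (\<rho> ` S) \<inter> space M" using inj by (auto dest: inj_onD)
    then show "S \<in> sets (vimage_algebra (space M) \<rho> borel)"
      using \<rho>[OF \<open>S \<subseteq> space M\<close>] S by (auto simp: sets_vimage_algebra2)
  next
    fix S assume "S \<in> sets (vimage_algebra (space M) \<rho> borel)"
    then obtain T where T: "T \<in> sets borel" "S = \<rho> -` T \<inter> space M" by (auto simp: sets_vimage_algebra2)
    then have "\<rho> ` S = T \<inter> \<rho> ` space M" by auto
    then show "S \<in> sets M" using \<rho>[of S] \<rho>[of "space M"] T by auto
  qed
  also have "vimage_algebra (space M) \<rho> borel = sigma (space M) {\<rho> -` T \<inter> space M |T. T \<in> A}"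
    unfolding borel_eq_countable_basis[OF A] by (rule vimage_algebra_sigma) auto
  also have "{\<rho> -` T \<inter> space M |T. T \<in> A} = (\<lambda>T. \<rho> -` T \<inter> space M) ` range (from_nat_into A)"
    unfolding range_from_nat_into[OF \<open>A \<noteq> {}\<close> A(1)] by auto
  also have "\<dots> = range U" unfolding U_def by (simp add: image_image)
  also have "sets (sigma (space M) (range U)) = sigma_sets (space M) (range U)"
    by (rule sets_measure_of) (auto simp: U_def)
  finally have sets: "sets M = sigma_sets (space M) (range U)" .
  show ?thesis
  proof (rule that[OF sets])
    fix x y assume xy: "x \<in> space M" "y \<in> space M" "x \<noteq> y"
    then have "\<rho> x \<noteq> \<rho> y" using inj by (auto dest: inj_onD)
    then have "\<rho> x \<in> - {\<rho> y}" "open (- {\<rho> y})" by auto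
    then obtain T where "T \<in> A" "\<rho> x \<in> T" "T \<subseteq> - {\<rho> y}" using topological_basisE[OF A(2)] by metis
    moreover obtain n where "from_nat_into A n = T" using from_nat_into_surj[OF A(1) \<open>T \<in> A\<close>] by blast
    ultimately show "\<exists>n. (x \<in> U n) \<noteq> (y \<in> U n)" unfolding U_def using xy by (intro exI[of _ n]) auto
  qed
qed

text \<open>Provides enough reals to serve as new nodes for all limit codes.\<close>

lemma countable_bool_functions_inject_real:
  "\<exists>h :: ('i::countable \<Rightarrow> bool) \<Rightarrow> real. inj h"
proof -
  obtain g :: "nat set \<Rightarrow> real" where "inj g"
    using eqpoll_imp_lepoll[OF nat_sets_eqpoll_reals] unfolding lepoll_def by auto
  have "inj (\<lambda>a :: 'i \<Rightarrow> bool. g (to_nat ` {i. a i}))"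
  proof (rule injI)
    fix a b :: "'i \<Rightarrow> bool" assume "g (to_nat ` {i. a i}) = g (to_nat ` {i. b i})"
    then have "(to_nat :: 'i \<Rightarrow> nat) ` {i. a i} = to_nat ` {i. b i}" using \<open>inj g\<close> by (rule injD[rotated])
    then have "{i. a i} = {i. b i}" by (simp only: inj_image_eq_iff[OF inj_to_nat])
    then show "a = b" by (simp add: set_eq_iff fun_eq_iff)
  qed
  then show ?thesis by blast
qed

lemma graphing_coloured_action:
  fixes M :: "'a measure"
  assumes "graphing D M E"
  obtains f U col K where "coloured_action M D f U col K"
    "\<And>x y. (x, y) \<in> E \<longleftrightarrow> x \<in> space M \<and> y \<noteq> x \<and> (\<exists>i<D. y = f i x)"
proof -
  have M: "standard_borel M" and E: "E \<in> sets (M \<Otimes>\<^sub>M M)" "sym E" "irrefl E"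
    and deg: "\<And>x. x \<in> space M \<Longrightarrow> finite {y \<in> space M. (x, y) \<in> E} \<and> card {y \<in> space M. (x, y) \<in> E} \<le> D"
    using assms unfolding graphing_def standard_prob_space_def deg_def by auto
  obtain f :: "nat \<Rightarrow> 'a \<Rightarrow> 'a" where f: "\<And>i. f i \<in> measurable M M"
    "\<And>x y. (x, y) \<in> E \<Longrightarrow> \<exists>i<D. y = f i x" "\<And>x i. x \<in> space M \<Longrightarrow> f i x = x \<or> (x, f i x) \<in> E"
    using bounded_degree_neighbour_functions[OF M E(1) deg] by blast
  obtain U :: "nat \<Rightarrow> 'a set" where U: "sets M = sigma_sets (space M) (range U)"
    "\<And>x y. x \<in> space M \<Longrightarrow> y \<in> space M \<Longrightarrow> x \<noteq> y \<Longrightarrow> \<exists>n. (x \<in> U n) \<noteq> (y \<in> U n)"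
    using standard_borel_generating_sequence[OF M] by blast
  interpret coded_action M D f U
  proof
    show "\<exists>j<D. f j (f i x) = x" if "x \<in> space M" "f i x \<noteq> x" for x i
      using f(2)[of "f i x" x] f(3)[of x i] that E(2) by (metis symD)
  qed (use f U in auto)
  have "\<forall>r. \<exists>c N. c \<in> measurable M (count_space UNIV) \<and> (\<forall>x. c x \<le> (N::nat)) \<and>
     (\<forall>x w. x \<in> space M \<longrightarrow> w \<in> words D r \<longrightarrow> fold f w x \<noteq> x \<longrightarrow> c (fold f w x) \<noteq> c x)"
  proof
    fix r show "\<exists>c N. c \<in> measurable M (count_space UNIV) \<and> (\<forall>x. c x \<le> (N::nat)) \<and>
       (\<forall>x w. x \<in> space M \<longrightarrow> w \<in> words D r \<longrightarrow> fold f w x \<noteq> x \<longrightarrow> c (fold f w x) \<noteq> c x)"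
      by (rule finite_colouring[of r]) blast
  qed
  then obtain col K where col: "\<forall>r. col r \<in> measurable M (count_space UNIV) \<and> (\<forall>x. col r x \<le> (K r::nat)) \<and>
     (\<forall>x w. x \<in> space M \<longrightarrow> w \<in> words D r \<longrightarrow> fold f w x \<noteq> x \<longrightarrow> col r (fold f w x) \<noteq> col r x)"
    by metis
  have "coloured_action M D f U col K" by unfold_locales (use col in auto)
  \<comment> \<open>A value \<open>f i x\<close> other than \<open>x\<close> is a neighbour, and
    irreflexivity excludes \<open>x\<close> itself.\<close>
  moreover have "(x, y) \<in> E \<longleftrightarrow> x \<in> space M \<and> y \<noteq> x \<and> (\<exists>i<D. y = f i x)" for x y
    using f(2,3) E(3) sets.sets_into_space[OF E(1)] unfolding irrefl_def space_pair_measure by blast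
  ultimately show ?thesis by (rule that)
qed

theorem theorem14:
  fixes D :: nat and M :: "'a measure" and E :: "('a \<times> 'a) set"
  assumes "D \<ge> 1" and "graphing D M E"
  shows "\<exists>(M' :: ('a + real) measure) E'.
           compact_graphing D M' E' \<and>
           strong_subgraphing (embed_measure M Inl) (edges_Inl E) M' E'"
proof -
  obtain f U col K where "coloured_action M D f U col K"
    and E: "\<And>x y. (x, y) \<in> E \<longleftrightarrow> x \<in> space M \<and> y \<noteq> x \<and> (\<exists>i<D. y = f i x)"
    using graphing_coloured_action[OF assms(2)] by blast
  interpret coloured_action M D f U col K by fact
  obtain h :: "code \<Rightarrow> real" where h: "inj h" using countable_bool_functions_inject_real by blast
  \<comment> \<open>Codes of given nodes are represented in the left summand; only the remaining
    limit codes get new nodes, so the labelling is a bijection.\<close>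
  define V :: "('a + real) set" where "V = Inl ` space M \<union> Inr ` h ` (codes - code_of ` space M)"
  \<comment> \<open>\<open>inv h\<close> decodes the new nodes, all of which are values of
    \<open>h\<close>.\<close>
  define l :: "'a + real \<Rightarrow> code" where "l = case_sum code_of (inv h)"
  have "inj_on l V"
    unfolding V_def l_def using inj_on_eq_iff[OF inj_code_of] h by (auto simp: inj_on_def)
  moreover have "l ` V = codes"
    unfolding V_def l_def image_Un image_image using h code_of_in_codes by (auto simp: image_iff)
  ultimately have "compactification M D f U col K V l Inl"
    by unfold_locales (auto simp: bij_betw_def V_def l_def)
  then interpret compactification M D f U col K V l Inl .
  show ?thesis
    using compact_graphing_closure[OF assms(2) E] strong_subgraphing_closure[OF inj_Inl E]
    unfolding edges_Inl_def by blast
qed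

end
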